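(* Let $X$ be $[0,1]$, $[0,\infty)$, $(-\infty,\infty)$ or $\mathbb{T}=[0,1]/\{0,1\}$, and let $B$ be a stable $C^*$-algebra such that $M(B)$ has real rank zero. Let $I=C(X)\otimes B$ if $X$ is compact and $I=C_0(X)\otimes B$ if $X$ is not compact. Then every projection $\mathbf{f}$ in $M(I)/I$ can be represented by a tuple $(f_0,f_1,\dots,f_n)$, associated with some finite partition $x_1<\cdots<x_n$ of $X$ into closed subintervals $X_0,\dots,X_n$, in which each $f_i$ is a strictly continuous projection-valued function $X_i\to M(B)$.
   Context: $M(\cdot)$ denotes the multiplier algebra, $M(B)_s$ is $M(B)$ with the strict topology, and $M(I)$ is identified with $C_b(X,M(B)_s)$, the bounded strictly continuous functions $X\to M(B)$. $C(X_i)\otimes B$ denotes the norm-continuous functions $X_i\to B$. Representation of elements of the corona algebra $\mathcal{C}(I)=M(I)/I$: take finitely many partition points $x_1<x_2<\cdots<x_n$ in the interior of $X$ (in $X\smallsetminus\{0,1\}$, i.e. in $(0,1)$, when $X=\mathbb{T}$), dividing $X$ (viewed as $[0,1]$ cut at the point $0=1$ when $X=\mathbb{T}$) into $n+1$ successive closed subintervals $X_0,X_1,\dots,X_n$, so that $X_{i-1}\cap X_i=\{x_i\}$ for $1\le i\le n$. Take $f_i\in C_b(X_i,M(B)_s)$ such that $f_i(x_i)-f_{i-1}(x_i)\in B$ for $i=1,\dots,n$ and, if $X=\mathbb{T}$, also $f_0(x_0)-f_n(x_0)\in B$ where $x_0=0=1$ (i.e. $f_0$ is evaluated at the endpoint $0$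 and $f_n$ at the endpoint $1$). The tuple $(f_0,\dots,f_n)$ represents the element of $\mathcal{C}(I)$ that is the coset of all $f\in M(I)$ such that $f|_{X_i}-f_i$ is a norm-continuous $B$-valued function on $X_i$ for every $i$, and $f-f_i$ vanishes in norm at any infinite end point of $X_i$. *)

theory Defs
  imports "HOL-Analysis.Analysis"
begin

section \<open>C*-algebras\<close>

class complex_normed_vector = real_normed_vector +
  fixes scaleC :: "complex \<Rightarrow> 'a \<Rightarrow> 'a" (infixr "*\<^sub>C" 75)
  assumes scaleC_of_real: "complex_of_real r *\<^sub>C x = r *\<^sub>R x"
    and scaleC_add_right: "c *\<^sub>C (x + y) = c *\<^sub>C x + c *\<^sub>C y"
    and scaleC_add_left: "(c + d) *\<^sub>C x = c *\<^sub>C x + d *\<^sub>C x"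
    and scaleC_scaleC: "c *\<^sub>C d *\<^sub>C x = (c * d) *\<^sub>C x"
    and norm_scaleC: "norm (c *\<^sub>C x) = cmod c * norm x"

lemma scaleC_zero_right [simp]: "c *\<^sub>C (0::'a::complex_normed_vector) = 0"
  using norm_scaleC[of c "0::'a"] by simp

lemma scaleC_minus_right: "c *\<^sub>C (- x) = - (c *\<^sub>C (x::'a::complex_normed_vector))"
  using scaleC_add_right[of c x "- x"] by (simp add: eq_neg_iff_add_eq_0 add.commute)

lemma scaleC_diff_right: "c *\<^sub>C (x - y) = c *\<^sub>C x - c *\<^sub>C (y::'a::complex_normed_vector)"
  using scaleC_add_right[of c x "- y"] by (simp add: scaleC_minus_right)

lemma scaleC_left_commute: "c *\<^sub>C d *\<^sub>C x = d *\<^sub>C c *\<^sub>C (x::'a::complex_normed_vector)"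
  by (simp add: scaleC_scaleC mult.commute)

lemma scaleC_scaleR_commute: "c *\<^sub>C r *\<^sub>R x = r *\<^sub>R c *\<^sub>C (x::'a::complex_normed_vector)"
  by (metis scaleC_of_real scaleC_left_commute)

text \<open>No unit is required, and the zero algebra is allowed.\<close>

class cstar_algebra = banach + real_normed_algebra + complex_normed_vector +
  fixes adj :: "'a \<Rightarrow> 'a" ("_\<^sup>\<star>" [1000] 999)
  assumes mult_scaleC_left: "(c *\<^sub>C x) * y = c *\<^sub>C (x * y)"
    and mult_scaleC_right: "x * (c *\<^sub>C y) = c *\<^sub>C (x * y)"
    and adj_add: "(x + y)\<^sup>\<star> = x\<^sup>\<star> + y\<^sup>\<star>"
    and adj_scaleC: "(c *\<^sub>C x)\<^sup>\<star> = cnj c *\<^sub>C x\<^sup>\<star>"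
    and adj_mult: "(x * y)\<^sup>\<star> = y\<^sup>\<star> * x\<^sup>\<star>"
    and adj_adj: "(x\<^sup>\<star>)\<^sup>\<star> = x"
    and norm_adj_mult_self: "norm (x\<^sup>\<star> * x) = (norm x)\<^sup>2"

definition is_projection :: "'a::cstar_algebra \<Rightarrow> bool" where
  "is_projection p \<longleftrightarrow> p * p = p \<and> p\<^sup>\<star> = p"

text \<open>
  The unit is supplied by \<^class>\<open>monoid_mult\<close> rather than \<^class>\<open>ring_1\<close>, because the multiplier
  algebra of the zero algebra is zero.
\<close>

definition real_rank_zero :: "'a::{cstar_algebra,monoid_mult} itself \<Rightarrow> bool" where
  "real_rank_zero _ \<longleftrightarrow>
     (\<forall>x::'a. x\<^sup>\<star> = x \<longrightarrow>
        (\<forall>e>0. \<exists>y. y\<^sup>\<star> = y \<and> (\<exists>z. y * z = 1 \<and> z * y = 1) \<and> norm (x - y) < e))"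

lemma adj_zero [simp]: "(0::'a::cstar_algebra)\<^sup>\<star> = 0"
  by (metis adj_add add_cancel_right_right)

lemma adj_scaleR: "(r *\<^sub>R x :: 'a::cstar_algebra)\<^sup>\<star> = r *\<^sub>R x\<^sup>\<star>"
  by (metis adj_scaleC complex_cnj_complex_of_real scaleC_of_real)

lemma norm_adj [simp]: "norm (x\<^sup>\<star>) = norm (x :: 'a::cstar_algebra)"
proof -
  have le: "norm y \<le> norm (y\<^sup>\<star>)" for y :: 'a
  proof (cases "norm y = 0")
    case False
    have "norm y * norm y \<le> norm (y\<^sup>\<star>) * norm y"
      by (metis norm_adj_mult_self norm_mult_ineq power2_eq_square)
    with False show ?thesis by simp
  qed simp
  from le[of x] le[of "x\<^sup>\<star>"] show ?thesis by (simp add: adj_adj)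
qed

lemma bounded_linear_adj: "bounded_linear (adj :: 'a::cstar_algebra \<Rightarrow> 'a)"
  by (rule bounded_linear_intro[where K = 1]) (simp_all add: adj_add adj_scaleR)

lemma bounded_linear_scaleC: "bounded_linear (\<lambda>x::'a::complex_normed_vector. c *\<^sub>C x)"
proof (rule bounded_linear_intro[where K = "cmod c"])
  show "c *\<^sub>C r *\<^sub>R x = r *\<^sub>R c *\<^sub>C x" for r and x :: 'a
    by (metis mult.commute scaleC_of_real scaleC_scaleC)
qed (simp_all add: scaleC_add_right norm_scaleC mult.commute)

instantiation blinfun :: (real_normed_vector, complex_normed_vector) complex_normed_vector
begin

lift_definition scaleC_blinfun :: "complex \<Rightarrow> ('a \<Rightarrow>\<^sub>L 'b) \<Rightarrow> ('a \<Rightarrow>\<^sub>L 'b)"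
  is "\<lambda>c f x. c *\<^sub>C f x"
  by (rule bounded_linear_compose[OF bounded_linear_scaleC])

instance
proof
  fix c d :: complex and r :: real and f g :: "'a \<Rightarrow>\<^sub>L 'b"
  show "complex_of_real r *\<^sub>C f = r *\<^sub>R f"
    by transfer (simp add: scaleC_of_real)
  show "c *\<^sub>C (f + g) = c *\<^sub>C f + c *\<^sub>C g"
    by transfer (simp add: scaleC_add_right)
  show "(c + d) *\<^sub>C f = c *\<^sub>C f + d *\<^sub>C f"
    by transfer (simp add: scaleC_add_left)
  show "c *\<^sub>C d *\<^sub>C f = (c * d) *\<^sub>C f"
    by transfer (simp add: scaleC_scaleC)
  show "norm (c *\<^sub>C f) = cmod c * norm f"
  proof transfer
    fix c and f :: "'a \<Rightarrow> 'b"
    assume bl: "bounded_linear f"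
    have "bounded_linear (\<lambda>x. c *\<^sub>C f x)"
      by (rule bounded_linear_compose[OF bounded_linear_scaleC bl])
    have le: "onorm (\<lambda>x. k *\<^sub>C h x) \<le> cmod k * onorm h"
      if "bounded_linear h" for k and h :: "'a \<Rightarrow> 'b"
    proof (rule onorm_bound)
      show "norm (k *\<^sub>C h x) \<le> cmod k * onorm h * norm x" for x
        using onorm[OF that, of x] by (simp add: norm_scaleC mult.assoc mult_left_mono)
    qed (simp add: onorm_pos_le[OF that])
    show "onorm (\<lambda>x. c *\<^sub>C f x) = cmod c * onorm f"
    proof (cases "c = 0")
      case True
      have "c *\<^sub>C y = 0" for y :: 'b using True norm_scaleC[of c y] by simp
      then show ?thesis using True by (simp add: onorm_zero)
    next
      case False
      have id: "(\<lambda>x. inverse c *\<^sub>C c *\<^sub>C f x) = f"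
        using False scaleC_of_real[of 1 "f _"] by (simp add: scaleC_scaleC)
      have "onorm f \<le> cmod (inverse c) * onorm (\<lambda>x. c *\<^sub>C f x)"
        using le[OF \<open>bounded_linear (\<lambda>x. c *\<^sub>C f x)\<close>, of "inverse c"] by (simp add: id)
      then have "cmod c * onorm f \<le> onorm (\<lambda>x. c *\<^sub>C f x)"
        using False by (simp add: norm_divide inverse_eq_divide pos_le_divide_eq mult.commute)
      with le[OF bl, of c] show ?thesis by simp
    qed
  qed
qed

end


section \<open>Multiplier algebras\<close>

text \<open>
  Double centralizers \<open>(L, R)\<close> of a C*-algebra: for \<open>m \<in> M(B)\<close> and \<open>b \<in> B\<close>, \<open>L b\<close> is \<open>m b\<close> and
  \<open>R b\<close> is \<open>b m\<close>.
\<close>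

typedef (overloaded) 'b multiplier =
  "{(L :: 'b::cstar_algebra \<Rightarrow>\<^sub>L 'b, R :: 'b \<Rightarrow>\<^sub>L 'b).
      (\<forall>c a. L (c *\<^sub>C a) = c *\<^sub>C L a) \<and>
      (\<forall>c a. R (c *\<^sub>C a) = c *\<^sub>C R a) \<and>
      (\<forall>a b. L (a * b) = L a * b) \<and>
      (\<forall>a b. R (a * b) = a * R b) \<and>
      (\<forall>a b. a * L b = R a * b)}"
  by (rule exI[of _ "(0, 0)"]) auto

setup_lifting type_definition_multiplier
lifting_forget blinfun.lifting

lift_definition lmul :: "'b::cstar_algebra multiplier \<Rightarrow> ('b \<Rightarrow>\<^sub>L 'b)" is fst .
lift_definition rmul :: "'b::cstar_algebra multiplier \<Rightarrow> ('b \<Rightarrow>\<^sub>L 'b)" is snd .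

lemma multiplier_eqI:
  assumes "\<And>b. lmul m b = lmul m' b" "\<And>b. rmul m b = rmul m' b"
  shows "m = m'"
proof -
  have "lmul m = lmul m'" "rmul m = rmul m'" using assms by (auto intro: blinfun_eqI)
  then show ?thesis by transfer (auto simp: prod_eq_iff)
qed

lemma multiplier_laws:
  "lmul m (c *\<^sub>C a) = c *\<^sub>C lmul m a"
  "rmul m (c *\<^sub>C a) = c *\<^sub>C rmul m a"
  "lmul m (a * b) = lmul m a * b"
  "rmul m (a * b) = a * rmul m b"
  "a * lmul m b = rmul m a * b"
  using Rep_multiplier[of m] by (simp_all add: lmul.rep_eq rmul.rep_eq case_prod_beta)

lemma norm_rmul: "norm (rmul m) = norm (lmul m)"
proof (rule antisym)
  show "norm (lmul m) \<le> norm (rmul m)"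
  proof (rule norm_blinfun_bound)
    fix b
    show "norm (lmul m b) \<le> norm (rmul m) * norm b"
    proof (cases "norm (lmul m b) = 0")
      case False
      have "norm (lmul m b) * norm (lmul m b) = norm (rmul m ((lmul m b)\<^sup>\<star>) * b)"
        unfolding multiplier_laws(5)[symmetric] norm_adj_mult_self power2_eq_square ..
      also have "\<dots> \<le> (norm (rmul m) * norm (lmul m b)) * norm b"
        using norm_blinfun[of "rmul m" "(lmul m b)\<^sup>\<star>"]
        by (intro order_trans[OF norm_mult_ineq] mult_right_mono) simp_all
      finally have "norm (lmul m b) * norm (lmul m b) \<le> norm (lmul m b) * (norm (rmul m) * norm b)"
        by (simp add: mult_ac)
      with False show ?thesis by (simp add: mult_le_cancel_left)
    qed simp
  qed simp
  show "norm (rmul m) \<le> norm (lmul m)"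
  proof (rule norm_blinfun_bound)
    fix b
    show "norm (rmul m b) \<le> norm (lmul m) * norm b"
    proof (cases "norm (rmul m b) = 0")
      case False
      have "norm (rmul m b) * norm (rmul m b) = norm (b * lmul m ((rmul m b)\<^sup>\<star>))"
        unfolding multiplier_laws(5) by (simp add: norm_adj_mult_self[of "_\<^sup>\<star>", simplified adj_adj norm_adj] power2_eq_square)
      also have "\<dots> \<le> norm b * (norm (lmul m) * norm (rmul m b))"
        using norm_blinfun[of "lmul m" "(rmul m b)\<^sup>\<star>"]
        by (intro order_trans[OF norm_mult_ineq] mult_left_mono) simp_all
      finally have "norm (rmul m b) * norm (rmul m b) \<le> norm (rmul m b) * (norm (lmul m) * norm b)"
        by (simp add: mult_ac)
      with False show ?thesis by (simp add: mult_le_cancel_left)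
    qed simp
  qed simp
qed

instantiation multiplier :: (cstar_algebra) "{real_normed_algebra,complex_normed_vector,monoid_mult}"
begin

lift_definition zero_multiplier :: "'a multiplier" is "(0, 0)" by simp

lift_definition one_multiplier :: "'a multiplier" is "(id_blinfun, id_blinfun)" by simp

lift_definition plus_multiplier :: "'a multiplier \<Rightarrow> 'a multiplier \<Rightarrow> 'a multiplier"
  is "\<lambda>(L, R) (L', R'). (L + L', R + R')"
  by (auto simp: blinfun.add_left scaleC_add_right ring_distribs)

lift_definition uminus_multiplier :: "'a multiplier \<Rightarrow> 'a multiplier"
  is "\<lambda>(L, R). (- L, - R)"
  by (auto simp: blinfun.minus_left scaleC_minus_right)

lift_definition minus_multiplier :: "'a multiplier \<Rightarrow> 'a multiplier \<Rightarrow> 'a multiplier"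
  is "\<lambda>(L, R) (L', R'). (L - L', R - R')"
  by (auto simp: blinfun.diff_left scaleC_diff_right ring_distribs)

lift_definition scaleR_multiplier :: "real \<Rightarrow> 'a multiplier \<Rightarrow> 'a multiplier"
  is "\<lambda>r (L, R). (r *\<^sub>R L, r *\<^sub>R R)"
  by (auto simp: blinfun.scaleR_left scaleC_scaleR_commute)

lift_definition scaleC_multiplier :: "complex \<Rightarrow> 'a multiplier \<Rightarrow> 'a multiplier"
  is "\<lambda>c (L, R). (c *\<^sub>C L, c *\<^sub>C R)"
  by (auto simp: scaleC_blinfun.rep_eq scaleC_left_commute mult_scaleC_left mult_scaleC_right)

lift_definition times_multiplier :: "'a multiplier \<Rightarrow> 'a multiplier \<Rightarrow> 'a multiplier"
  is "\<lambda>(L, R) (L', R'). (L o\<^sub>L L', R' o\<^sub>L R)"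
  by auto

definition norm_multiplier :: "'a multiplier \<Rightarrow> real" where
  "norm_multiplier m = norm (lmul m)"

definition sgn_multiplier :: "'a multiplier \<Rightarrow> 'a multiplier" where
  "sgn_multiplier m = inverse (norm m) *\<^sub>R m"

definition dist_multiplier :: "'a multiplier \<Rightarrow> 'a multiplier \<Rightarrow> real" where
  "dist_multiplier m m' = norm (m - m')"

definition uniformity_multiplier :: "('a multiplier \<times> 'a multiplier) filter" where
  "uniformity_multiplier = (INF e\<in>{0<..}. principal {(x, y). dist x y < e})"

definition open_multiplier :: "'a multiplier set \<Rightarrow> bool" where
  "open_multiplier U \<longleftrightarrow> (\<forall>x\<in>U. eventually (\<lambda>(x', y). x' = x \<longrightarrow> y \<in> U) uniformity)"

lemma lmul_simps [simp]:
  "lmul (0::'a multiplier) = 0"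
  "lmul (1::'a multiplier) = id_blinfun"
  "lmul (m + m') = lmul m + lmul m'"
  "lmul (- m) = - lmul m"
  "lmul (m - m') = lmul m - lmul m'"
  "lmul (r *\<^sub>R m) = r *\<^sub>R lmul m"
  "lmul (c *\<^sub>C m) = c *\<^sub>C lmul m"
  "lmul (m * m') = lmul m o\<^sub>L lmul m'"
  for m m' :: "'a multiplier"
  by (transfer; auto)+

lemma rmul_simps [simp]:
  "rmul (0::'a multiplier) = 0"
  "rmul (1::'a multiplier) = id_blinfun"
  "rmul (m + m') = rmul m + rmul m'"
  "rmul (- m) = - rmul m"
  "rmul (m - m') = rmul m - rmul m'"
  "rmul (r *\<^sub>R m) = r *\<^sub>R rmul m"
  "rmul (c *\<^sub>C m) = c *\<^sub>C rmul m"
  "rmul (m * m') = rmul m' o\<^sub>L rmul m"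
  for m m' :: "'a multiplier"
  by (transfer; auto)+

instance
proof
  fix a b c :: "'a multiplier" and r s :: real and k l :: complex
  note eqI = multiplier_eqI
  note simps = blinfun.add_left blinfun.diff_left blinfun.minus_left blinfun.scaleR_left
    blinfun.add_right blinfun.scaleR_right scaleC_blinfun.rep_eq
  show "a + b + c = a + (b + c)" by (rule eqI) (simp_all add: simps)
  show "a + b = b + a" by (rule eqI) (simp_all add: simps)
  show "0 + a = a" by (rule eqI) (simp_all add: simps)
  show "- a + a = 0" by (rule eqI) (simp_all add: simps)
  show "a - b = a + - b" by (rule eqI) (simp_all add: simps)
  show "r *\<^sub>R (a + b) = r *\<^sub>R a + r *\<^sub>R b" by (rule eqI) (simp_all add: simps scaleR_right_distrib)
  show "(r + s) *\<^sub>R a = r *\<^sub>R a + s *\<^sub>R a" by (rule eqI) (simp_all add: simps scaleR_left_distrib)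
  show "r *\<^sub>R s *\<^sub>R a = (r * s) *\<^sub>R a" by (rule eqI) (simp_all add: simps)
  show "1 *\<^sub>R a = a" by (rule eqI) (simp_all add: simps)
  show "a * b * c = a * (b * c)" by (rule eqI) (simp_all add: simps)
  show "(a + b) * c = a * c + b * c" by (rule eqI) (simp_all add: simps)
  show "a * (b + c) = a * b + a * c" by (rule eqI) (simp_all add: simps)
  show "(r *\<^sub>R a) * b = r *\<^sub>R (a * b)" by (rule eqI) (simp_all add: simps)
  show "a * (r *\<^sub>R b) = r *\<^sub>R (a * b)" by (rule eqI) (simp_all add: simps)
  show "1 * a = a" by (rule eqI) simp_all
  show "a * 1 = a" by (rule eqI) simp_all
  show "sgn a = inverse (norm a) *\<^sub>R a" by (rule sgn_multiplier_def)
  show "dist a b = norm (a - b)" by (rule dist_multiplier_def)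
  show "uniformity = (INF e\<in>{0<..}. principal {(x, y :: 'a multiplier). dist x y < e})"
    by (rule uniformity_multiplier_def)
  show "open U \<longleftrightarrow> (\<forall>x\<in>U. eventually (\<lambda>(x', y). x' = x \<longrightarrow> y \<in> U) uniformity)"
    for U :: "'a multiplier set"
    by (rule open_multiplier_def)
  show "norm a = 0 \<longleftrightarrow> a = 0"
  proof
    assume "norm a = 0"
    then have "lmul a = 0" "rmul a = 0"
      using norm_rmul[of a] by (simp_all add: norm_multiplier_def)
    then show "a = 0" by (intro eqI) simp_all
  qed (simp add: norm_multiplier_def)
  show "norm (a + b) \<le> norm a + norm b" by (simp add: norm_multiplier_def norm_triangle_ineq)
  show "norm (r *\<^sub>R a) = \<bar>r\<bar> * norm a" by (simp add: norm_multiplier_def)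
  show "norm (a * b) \<le> norm a * norm b" by (simp add: norm_multiplier_def norm_blinfun_compose)
  show "complex_of_real r *\<^sub>C a = r *\<^sub>R a" by (rule eqI) (simp_all add: scaleC_of_real)
  show "k *\<^sub>C (a + b) = k *\<^sub>C a + k *\<^sub>C b" by (rule eqI) (simp_all add: scaleC_add_right)
  show "(k + l) *\<^sub>C a = k *\<^sub>C a + l *\<^sub>C a" by (rule eqI) (simp_all add: scaleC_add_left)
  show "k *\<^sub>C l *\<^sub>C a = (k * l) *\<^sub>C a" by (rule eqI) (simp_all add: scaleC_scaleC)
  show "norm (k *\<^sub>C a) = cmod k * norm a" by (simp add: norm_multiplier_def norm_scaleC)
qed

end

instantiation multiplier :: (cstar_algebra) cstar_algebra
begin

lift_definition adj_multiplier :: "'a multiplier \<Rightarrow> 'a multiplier"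
  is "\<lambda>(L, R). (Blinfun adj o\<^sub>L R o\<^sub>L Blinfun adj, Blinfun adj o\<^sub>L L o\<^sub>L Blinfun adj)"
proof (clarsimp simp: bounded_linear_Blinfun_apply[OF bounded_linear_adj] adj_scaleC adj_mult adj_adj)
  fix L R :: "'a \<Rightarrow>\<^sub>L 'a" and a b
  assume "\<forall>a b. a * L b = R a * b"
  then have "b\<^sup>\<star> * L (a\<^sup>\<star>) = R (b\<^sup>\<star>) * a\<^sup>\<star>" by blast
  then show "a * (R (b\<^sup>\<star>))\<^sup>\<star> = (L (a\<^sup>\<star>))\<^sup>\<star> * b"
    by (metis adj_mult adj_adj)
qed

lemma adj_multiplier_simps [simp]:
  "lmul (m\<^sup>\<star>) a = (rmul m (a\<^sup>\<star>))\<^sup>\<star>"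
  "rmul (m\<^sup>\<star>) a = (lmul m (a\<^sup>\<star>))\<^sup>\<star>"
  for m :: "'a multiplier"
  by (transfer; auto simp: bounded_linear_Blinfun_apply[OF bounded_linear_adj])+

instance
proof
  fix a b :: "'a multiplier" and k :: complex
  note eqI = multiplier_eqI
  note simps = blinfun.add_left blinfun.add_right scaleC_blinfun.rep_eq
  show "(k *\<^sub>C a) * b = k *\<^sub>C (a * b)"
    by (rule eqI) (simp_all add: simps multiplier_laws)
  show "a * (k *\<^sub>C b) = k *\<^sub>C (a * b)"
    by (rule eqI) (simp_all add: simps multiplier_laws)
  show "(a + b)\<^sup>\<star> = a\<^sup>\<star> + b\<^sup>\<star>" by (rule eqI) (simp_all add: simps adj_add)
  show "(k *\<^sub>C a)\<^sup>\<star> = cnj k *\<^sub>C a\<^sup>\<star>" by (rule eqI) (simp_all add: simps adj_scaleC)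
  show "(a * b)\<^sup>\<star> = b\<^sup>\<star> * a\<^sup>\<star>" by (rule eqI) (simp_all add: adj_adj)
  show star_star: "(a\<^sup>\<star>)\<^sup>\<star> = a" for a :: "'a multiplier" by (rule eqI) (simp_all add: adj_adj)
  have norm_star_le: "norm (lmul (m\<^sup>\<star>)) \<le> norm (lmul m)" for m :: "'a multiplier"
  proof (rule norm_blinfun_bound)
    show "norm (lmul (m\<^sup>\<star>) x) \<le> norm (lmul m) * norm x" for x
      using norm_blinfun[of "rmul m" "x\<^sup>\<star>"] by (simp add: norm_rmul)
  qed simp
  show "norm (a\<^sup>\<star> * a) = (norm a)\<^sup>2"
  proof (rule antisym)
    show "norm (a\<^sup>\<star> * a) \<le> (norm a)\<^sup>2"
      using norm_blinfun_compose[of "lmul (a\<^sup>\<star>)" "lmul a"]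
        mult_right_mono[OF norm_star_le[of a], of "norm (lmul a)"]
      by (simp add: norm_multiplier_def power2_eq_square)
    let ?N = "norm (lmul (a\<^sup>\<star>) o\<^sub>L lmul a)"
    have "norm (lmul a) \<le> sqrt ?N"
    proof (rule norm_blinfun_bound)
      fix x
      have "(lmul (a\<^sup>\<star>) (lmul a x))\<^sup>\<star> = rmul a ((lmul a x)\<^sup>\<star>)" by (simp add: adj_adj)
      then have "(norm (lmul a x))\<^sup>2 = norm ((lmul (a\<^sup>\<star>) (lmul a x))\<^sup>\<star> * x)"
        by (metis norm_adj_mult_self multiplier_laws(5))
      also have "\<dots> \<le> norm (lmul (a\<^sup>\<star>) (lmul a x)) * norm x"
        by (metis norm_mult_ineq norm_adj)
      also have "\<dots> \<le> (?N * norm x) * norm x"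
        by (rule mult_right_mono) (use norm_blinfun[of "lmul (a\<^sup>\<star>) o\<^sub>L lmul a" x] in simp_all)
      also have "\<dots> = (sqrt ?N * norm x)\<^sup>2" by (simp add: power2_eq_square)
      finally show "norm (lmul a x) \<le> sqrt ?N * norm x"
        by (rule power2_le_imp_le) simp
    qed simp
    then have "(norm (lmul a))\<^sup>2 \<le> (sqrt ?N)\<^sup>2" by (rule power_mono) simp
    then show "(norm a)\<^sup>2 \<le> norm (a\<^sup>\<star> * a)" by (simp add: norm_multiplier_def)
  qed
next
  fix m :: "nat \<Rightarrow> 'a multiplier"
  assume "Cauchy m"
  then have C: "\<forall>e>0. \<exists>M. \<forall>i\<ge>M. \<forall>j\<ge>M. norm (m i - m j) < e"
    by (simp add: Cauchy_def dist_norm)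
  have "norm (rmul (m i) - rmul (m j)) = norm (lmul (m i) - lmul (m j))" for i j
    using norm_rmul[of "m i - m j"] by simp
  with C have "Cauchy (\<lambda>i. lmul (m i))" "Cauchy (\<lambda>i. rmul (m i))"
    by (simp_all add: Cauchy_def dist_norm norm_multiplier_def)
  then obtain L R where L: "(\<lambda>i. lmul (m i)) \<longlonglongrightarrow> L" and R: "(\<lambda>i. rmul (m i)) \<longlonglongrightarrow> R"
    by (metis Cauchy_convergent convergent_def)
  note LR = blinfun.tendsto[OF L tendsto_const] blinfun.tendsto[OF R tendsto_const]
  have scl: "(\<lambda>i. c *\<^sub>C f i) \<longlonglongrightarrow> c *\<^sub>C y" if "f \<longlonglongrightarrow> y" for f and y :: 'a and c
    by (rule bounded_linear.tendsto[OF bounded_linear_scaleC that])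
  have "L (c *\<^sub>C a) = c *\<^sub>C L a" for c a
    using LIMSEQ_unique[OF LR(1)[of "c *\<^sub>C a"]] scl[OF LR(1)[of a], of c]
    by (simp add: multiplier_laws)
  moreover have "R (c *\<^sub>C a) = c *\<^sub>C R a" for c a
    using LIMSEQ_unique[OF LR(2)[of "c *\<^sub>C a"]] scl[OF LR(2)[of a], of c]
    by (simp add: multiplier_laws)
  moreover have "L (a * b) = L a * b" for a b
    using LIMSEQ_unique[OF LR(1)[of "a * b"]] tendsto_mult_right[OF LR(1)[of a], of b]
    by (simp add: multiplier_laws)
  moreover have "R (a * b) = a * R b" for a b
    using LIMSEQ_unique[OF LR(2)[of "a * b"]] tendsto_mult_left[OF LR(2)[of b], of a]
    by (simp add: multiplier_laws)
  moreover have "a * L b = R a * b" for a b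
    using LIMSEQ_unique[OF tendsto_mult_left[OF LR(1)[of b], of a]]
      tendsto_mult_right[OF LR(2)[of a], of b]
    by (simp add: multiplier_laws)
  ultimately obtain n where n: "lmul n = L" "rmul n = R"
    using that[of "Abs_multiplier (L, R)"] Abs_multiplier_inverse[of "(L, R)"]
    by (auto simp: lmul.rep_eq rmul.rep_eq)
  have "(\<lambda>i. norm (m i - n)) \<longlonglongrightarrow> 0"
    using tendsto_norm_zero[OF LIM_zero[OF L]] n by (simp add: norm_multiplier_def)
  then have "m \<longlonglongrightarrow> n"
    by (rule Lim_null[THEN iffD2, OF tendsto_norm_zero_cancel])
  then show "convergent m" by (auto simp: convergent_def)
qed

end

lift_definition multiplier_of :: "'b::cstar_algebra \<Rightarrow> 'b multiplier"
  is "\<lambda>b. (blinfun_mult_right b, blinfun_mult_left b)"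
  by (auto simp: mult_scaleC_left mult_scaleC_right mult.assoc)

definition strict_topology :: "'b::cstar_algebra multiplier topology" where
  "strict_topology = topology_generated_by
     ({{m. norm (lmul (m - m\<^sub>0) b) < e} | m\<^sub>0 b e. e > 0} \<union>
      {{m. norm (rmul (m - m\<^sub>0) b) < e} | m\<^sub>0 b e. e > 0})"


section \<open>Stability\<close>

typedef ell2 = "{x :: nat \<Rightarrow> complex. summable (\<lambda>n. (cmod (x n))\<^sup>2)}"
  by (rule exI[of _ "\<lambda>_. 0"]) simp

setup_lifting type_definition_ell2

lift_definition ell2_nth :: "ell2 \<Rightarrow> nat \<Rightarrow> complex" is "\<lambda>x. x" .

definition ell2_inner :: "ell2 \<Rightarrow> ell2 \<Rightarrow> complex" where
  "ell2_inner x y = (\<Sum>n. cnj (ell2_nth x n) * ell2_nth y n)"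

lemma ell2_triangle:
  fixes x y :: "nat \<Rightarrow> complex"
  assumes x: "summable (\<lambda>n. (cmod (x n))\<^sup>2)" and y: "summable (\<lambda>n. (cmod (y n))\<^sup>2)"
  shows "summable (\<lambda>n. (cmod (x n + y n))\<^sup>2)"
    and "sqrt (\<Sum>n. (cmod (x n + y n))\<^sup>2) \<le> sqrt (\<Sum>n. (cmod (x n))\<^sup>2) + sqrt (\<Sum>n. (cmod (y n))\<^sup>2)"
      (is "_ \<le> ?B")
proof -
  have part: "L2_set (\<lambda>n. cmod (z n)) {..<N} \<le> sqrt (\<Sum>n. (cmod (z n))\<^sup>2)"
    if "summable (\<lambda>n. (cmod (z n))\<^sup>2)" for z :: "nat \<Rightarrow> complex" and N
    unfolding L2_set_def by (rule real_sqrt_le_mono) (rule sum_le_suminf[OF that], auto)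
  have B: "(\<Sum>n<N. (cmod (x n + y n))\<^sup>2) \<le> ?B\<^sup>2" for N
  proof -
    have "L2_set (\<lambda>n. cmod (x n + y n)) {..<N} \<le> L2_set (\<lambda>n. cmod (x n) + cmod (y n)) {..<N}"
      by (rule L2_set_mono) (auto intro: norm_triangle_ineq)
    also have "\<dots> \<le> ?B"
      using L2_set_triangle_ineq[of "\<lambda>n. cmod (x n)" "\<lambda>n. cmod (y n)" "{..<N}"]
        part[OF x, of N] part[OF y, of N] by linarith
    finally show ?thesis by (simp add: L2_set_def real_sqrt_le_iff' sum_nonneg sqrt_le_D)
  qed
  show s: "summable (\<lambda>n. (cmod (x n + y n))\<^sup>2)"
    by (rule summableI_nonneg_bounded[OF _ B]) simp
  have "(\<Sum>n. (cmod (x n + y n))\<^sup>2) \<le> ?B\<^sup>2"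
    by (rule suminf_le_const[OF s B])
  moreover have "0 \<le> ?B" by (simp add: suminf_nonneg x y)
  ultimately show "sqrt (\<Sum>n. (cmod (x n + y n))\<^sup>2) \<le> ?B"
    by (rule real_le_lsqrt[rotated])
qed

instantiation ell2 :: complex_normed_vector
begin

lift_definition zero_ell2 :: ell2 is "\<lambda>_. 0" by simp
lift_definition plus_ell2 :: "ell2 \<Rightarrow> ell2 \<Rightarrow> ell2" is "\<lambda>x y n. x n + y n"
  by (rule ell2_triangle)
lift_definition uminus_ell2 :: "ell2 \<Rightarrow> ell2" is "\<lambda>x n. - x n" by simp
lift_definition minus_ell2 :: "ell2 \<Rightarrow> ell2 \<Rightarrow> ell2" is "\<lambda>x y n. x n - y n"
  subgoal for x y using ell2_triangle(1)[of x "\<lambda>n. - y n"] by simp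
  done
lift_definition scaleC_ell2 :: "complex \<Rightarrow> ell2 \<Rightarrow> ell2" is "\<lambda>c x n. c * x n"
  by (simp add: norm_mult power_mult_distrib summable_mult)
lift_definition scaleR_ell2 :: "real \<Rightarrow> ell2 \<Rightarrow> ell2" is "\<lambda>r x n. r *\<^sub>R x n"
  by (simp add: power_mult_distrib summable_mult)
lift_definition norm_ell2 :: "ell2 \<Rightarrow> real" is "\<lambda>x. sqrt (\<Sum>n. (cmod (x n))\<^sup>2)" .

definition sgn_ell2 :: "ell2 \<Rightarrow> ell2" where
  "sgn_ell2 x = inverse (norm x) *\<^sub>R x"

definition dist_ell2 :: "ell2 \<Rightarrow> ell2 \<Rightarrow> real" where
  "dist_ell2 x y = norm (x - y)"

definition uniformity_ell2 :: "(ell2 \<times> ell2) filter" where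
  "uniformity_ell2 = (INF e\<in>{0<..}. principal {(x, y). dist x y < e})"

definition open_ell2 :: "ell2 set \<Rightarrow> bool" where
  "open_ell2 U \<longleftrightarrow> (\<forall>x\<in>U. eventually (\<lambda>(x', y). x' = x \<longrightarrow> y \<in> U) uniformity)"

instance
proof
  fix x y z :: ell2 and r s :: real and c d :: complex
  show "x + y + z = x + (y + z)" by transfer (simp add: add.assoc)
  show "x + y = y + x" by transfer (simp add: add.commute)
  show "0 + x = x" by transfer simp
  show "- x + x = 0" by transfer simp
  show "x - y = x + - y" by transfer simp
  show "r *\<^sub>R (x + y) = r *\<^sub>R x + r *\<^sub>R y" by transfer (simp add: scaleR_right_distrib)
  show "(r + s) *\<^sub>R x = r *\<^sub>R x + s *\<^sub>R x" by transfer (simp add: scaleR_left_distrib)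
  show "r *\<^sub>R s *\<^sub>R x = (r * s) *\<^sub>R x" by transfer simp
  show "1 *\<^sub>R x = x" by transfer simp
  show "sgn x = inverse (norm x) *\<^sub>R x" by (rule sgn_ell2_def)
  show "dist x y = norm (x - y)" by (rule dist_ell2_def)
  show "uniformity = (INF e\<in>{0<..}. principal {(x, y :: ell2). dist x y < e})"
    by (rule uniformity_ell2_def)
  show "open U \<longleftrightarrow> (\<forall>x\<in>U. eventually (\<lambda>(x', y). x' = x \<longrightarrow> y \<in> U) uniformity)"
    for U :: "ell2 set"
    by (rule open_ell2_def)
  show "norm x = 0 \<longleftrightarrow> x = 0"
    by transfer (auto simp: suminf_eq_zero_iff)
  show "norm (x + y) \<le> norm x + norm y" by transfer (rule ell2_triangle(2))
  show "norm (r *\<^sub>R x) = \<bar>r\<bar> * norm x"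
    by transfer (simp add: power_mult_distrib suminf_mult real_sqrt_mult)
  show "complex_of_real r *\<^sub>C x = r *\<^sub>R x" by transfer (simp add: scaleR_conv_of_real)
  show "c *\<^sub>C (x + y) = c *\<^sub>C x + c *\<^sub>C y" by transfer (simp add: distrib_left)
  show "(c + d) *\<^sub>C x = c *\<^sub>C x + d *\<^sub>C x" by transfer (simp add: distrib_right)
  show "c *\<^sub>C d *\<^sub>C x = (c * d) *\<^sub>C x" by transfer (simp add: mult.assoc)
  show "norm (c *\<^sub>C x) = cmod c * norm x"
    by transfer (simp add: norm_mult power_mult_distrib suminf_mult real_sqrt_mult)
qed

end

definition compact_operators :: "(ell2 \<Rightarrow>\<^sub>L ell2) set" where
  "compact_operators =
     {T. (\<forall>c x. blinfun_apply T (c *\<^sub>C x) = c *\<^sub>C blinfun_apply T x) \<and> compact (closure (blinfun_apply T ` cball 0 1))}"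

text \<open>
  \<open>\<iota> b T\<close> plays the role of \<open>b \<otimes> T\<close>: it induces an injective *-homomorphism of the algebraic tensor
  product of \<open>B\<close> and the compact operators into \<open>C\<close>, with dense range, so that \<open>C\<close> is the completion
  of the algebraic tensor product in a C*-norm.  Since the compact operators are nuclear, that
  C*-norm is unique (and a cross norm), so that \<open>C\<close> is the C*-algebra \<open>B \<otimes> K\<close>.
  The range spans the same real and complex subspace because \<open>c *\<^sub>C \<iota> b T = \<iota> (c *\<^sub>C b) T\<close>.
\<close>

definition is_tensor_compact ::
  "('b::cstar_algebra \<Rightarrow> (ell2 \<Rightarrow>\<^sub>L ell2) \<Rightarrow> 'c::cstar_algebra) \<Rightarrow> bool" where
  "is_tensor_compact \<iota> \<longleftrightarrow>
     (\<forall>a b. \<forall>T\<in>compact_operators. \<iota> (a + b) T = \<iota> a T + \<iota> b T) \<and>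
     (\<forall>b. \<forall>S\<in>compact_operators. \<forall>T\<in>compact_operators. \<iota> b (S + T) = \<iota> b S + \<iota> b T) \<and>
     (\<forall>c b. \<forall>T\<in>compact_operators. \<iota> (c *\<^sub>C b) T = c *\<^sub>C \<iota> b T \<and> \<iota> b (c *\<^sub>C T) = c *\<^sub>C \<iota> b T) \<and>
     (\<forall>a b. \<forall>S\<in>compact_operators. \<forall>T\<in>compact_operators. \<iota> a S * \<iota> b T = \<iota> (a * b) (S o\<^sub>L T)) \<and>
     (\<forall>b. \<forall>S\<in>compact_operators. \<forall>T\<in>compact_operators.
        (\<forall>x y. ell2_inner (blinfun_apply S x) y = ell2_inner x (blinfun_apply T y)) \<longrightarrow> (\<iota> b S)\<^sup>\<star> = \<iota> (b\<^sup>\<star>) T) \<and>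
     (\<forall>b. \<forall>T\<in>compact_operators. norm (\<iota> b T) = norm b * norm T) \<and>
     (\<forall>n (b :: nat \<Rightarrow> 'b) T.
        (\<forall>c. (\<Sum>i<n. c i *\<^sub>C b i) = 0 \<longrightarrow> (\<forall>i<n. c i = 0)) \<longrightarrow>
        (\<forall>i<n. T i \<in> compact_operators) \<longrightarrow>
        (\<Sum>i<n. \<iota> (b i) (T i)) = 0 \<longrightarrow> (\<forall>i<n. T i = 0)) \<and>
     closure (span {\<iota> b T | b T. T \<in> compact_operators}) = UNIV"

definition stable_cstar :: "'b::cstar_algebra itself \<Rightarrow> bool" where
  "stable_cstar _ \<longleftrightarrow> (\<exists>\<iota> :: 'b \<Rightarrow> (ell2 \<Rightarrow>\<^sub>L ell2) \<Rightarrow> 'b. is_tensor_compact \<iota>)"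


section \<open>The corona algebra of \<open>C(X) \<otimes> B\<close>\<close>

datatype base_space = Unit_Interval | Half_Line | Real_Line | Circle

text \<open>
  The circle is the quotient of \<open>[0,1]\<close> that identifies the end points, so functions on it are
  functions on \<open>[0,1]\<close> that satisfy \<open>closes_up\<close>.
\<close>

fun points :: "base_space \<Rightarrow> real set" where
  "points Unit_Interval = {0..1}"
| "points Half_Line = {0..}"
| "points Real_Line = UNIV"
| "points Circle = {0..1}"

definition closes_up :: "base_space \<Rightarrow> (real \<Rightarrow> 'a) \<Rightarrow> bool" where
  "closes_up X f \<longleftrightarrow> (X = Circle \<longrightarrow> f 0 = f 1)"

text \<open>Norm-continuous functions that vanish at infinity; on a compact \<open>S\<close> the second condition is void.\<close>

definition C0_on :: "real set \<Rightarrow> (real \<Rightarrow> 'b::real_normed_vector) set" where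
  "C0_on S = {h. continuous_on S h \<and>
     (\<forall>e>0. \<exists>K\<subseteq>S. compact K \<and> (\<forall>t\<in>S - K. norm (h t) < e))}"

definition strict_Cb_on :: "real set \<Rightarrow> (real \<Rightarrow> 'b::cstar_algebra multiplier) set" where
  "strict_Cb_on S = {f. continuous_map (top_of_set S) strict_topology f \<and> bounded (f ` S)}"

text \<open>
  \<open>I\<close> and \<open>M(I) = C\<^sub>b(X, M(B)\<^sub>s)\<close>, with functions set to \<open>0\<close> off \<open>X\<close> and \<open>I\<close> embedded in \<open>M(I)\<close>.
\<close>

definition algebra_I :: "base_space \<Rightarrow> (real \<Rightarrow> 'b::cstar_algebra multiplier) set" where
  "algebra_I X = {f. \<exists>h\<in>C0_on (points X). closes_up X h \<and>
     f = (\<lambda>t. if t \<in> points X then multiplier_of (h t) else 0)}"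

definition multiplier_I :: "base_space \<Rightarrow> (real \<Rightarrow> 'b::cstar_algebra multiplier) set" where
  "multiplier_I X = {f \<in> strict_Cb_on (points X). closes_up X f \<and> (\<forall>t. t \<notin> points X \<longrightarrow> f t = 0)}"

definition corona_rel ::
  "base_space \<Rightarrow> ((real \<Rightarrow> 'b::cstar_algebra multiplier) \<times> (real \<Rightarrow> 'b multiplier)) set" where
  "corona_rel X = {(f, g). f \<in> multiplier_I X \<and> g \<in> multiplier_I X \<and>
     (\<lambda>t. f t - g t) \<in> algebra_I X}"

definition corona :: "base_space \<Rightarrow> (real \<Rightarrow> 'b::cstar_algebra multiplier) set set" where
  "corona X = multiplier_I X // corona_rel X"

definition corona_mult ::
  "base_space \<Rightarrow> (real \<Rightarrow> 'b::cstar_algebra multiplier) set \<Rightarrow> (real \<Rightarrow> 'b multiplier) set \<Rightarrow>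
   (real \<Rightarrow> 'b multiplier) set" where
  "corona_mult X P Q = (\<Union>f\<in>P. \<Union>g\<in>Q. corona_rel X `` {\<lambda>t. f t * g t})"

definition corona_adj ::
  "base_space \<Rightarrow> (real \<Rightarrow> 'b::cstar_algebra multiplier) set \<Rightarrow> (real \<Rightarrow> 'b multiplier) set" where
  "corona_adj X P = (\<Union>f\<in>P. corona_rel X `` {\<lambda>t. (f t)\<^sup>\<star>})"

definition corona_projection ::
  "base_space \<Rightarrow> (real \<Rightarrow> 'b::cstar_algebra multiplier) set \<Rightarrow> bool" where
  "corona_projection X P \<longleftrightarrow> P \<in> corona X \<and> corona_mult X P P = P \<and> corona_adj X P = P"


section \<open>Representation by tuples\<close>

text \<open>The interior of \<open>X\<close> is \<open>(0,1)\<close> for the interval as well as for the circle cut open at \<open>0 = 1\<close>.\<close>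

definition is_partition :: "base_space \<Rightarrow> nat \<Rightarrow> (nat \<Rightarrow> real) \<Rightarrow> bool" where
  "is_partition X n x \<longleftrightarrow>
     (\<forall>i\<in>{1..n}. x i \<in> interior (points X)) \<and> (\<forall>i\<in>{1..<n}. x i < x (i + 1))"

definition piece :: "base_space \<Rightarrow> nat \<Rightarrow> (nat \<Rightarrow> real) \<Rightarrow> nat \<Rightarrow> real set" where
  "piece X n x i = {t \<in> points X. (1 \<le> i \<longrightarrow> x i \<le> t) \<and> (i < n \<longrightarrow> t \<le> x (i + 1))}"

definition is_tuple ::
  "base_space \<Rightarrow> nat \<Rightarrow> (nat \<Rightarrow> real) \<Rightarrow> (nat \<Rightarrow> real \<Rightarrow> 'b::cstar_algebra multiplier) \<Rightarrow> bool" where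
  "is_tuple X n x f \<longleftrightarrow>
     (\<forall>i\<le>n. f i \<in> strict_Cb_on (piece X n x i)) \<and>
     (\<forall>i\<in>{1..n}. f i (x i) - f (i - 1) (x i) \<in> range multiplier_of) \<and>
     (X = Circle \<longrightarrow> f 0 0 - f n 1 \<in> range multiplier_of)"

definition tuple_class ::
  "base_space \<Rightarrow> nat \<Rightarrow> (nat \<Rightarrow> real) \<Rightarrow> (nat \<Rightarrow> real \<Rightarrow> 'b::cstar_algebra multiplier) \<Rightarrow>
   (real \<Rightarrow> 'b multiplier) set" where
  "tuple_class X n x f = {g \<in> multiplier_I X. \<forall>i\<le>n. \<exists>h\<in>C0_on (piece X n x i).
     \<forall>t\<in>piece X n x i. g t - f i t = multiplier_of (h t)}"

lifting_update blinfun.lifting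

end

theory Submission
  imports Defs
begin

text \<open>
  Let \<open>f\<close> be a self-adjoint representative of the given projection and \<open>F = 2 f - 1\<close>, so that \<open>F\<^sup>2 - 1\<close>
  is a norm-continuous \<open>B\<close>-valued function.  Wherever \<open>F\<^sup>2\<close> is norm-close to 1, the function
  \<open>F (F\<^sup>2)\<^sup>-\<^sup>1\<^sup>/\<^sup>2\<close>, given by the binomial series, is a strictly continuous symmetry that differs from \<open>F\<close>
  by a norm-continuous \<open>B\<close>-valued function.  This covers a neighbourhood of infinity.  Near a finite
  point \<open>s\<close>, real rank zero of \<open>M(B)\<close> yields a symmetry \<open>u\<close> with \<open>u - F s \<in> B\<close>, and the same argument
  applies to \<open>F + (u - F s)\<close>, whose square is 1 at \<open>s\<close>.  A Lebesgue number argument on the remaining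
  compact interval provides the partition.
\<close>

section \<open>The binomial series of the inverse square root\<close>

text \<open>Passing from projections to symmetries turns idempotency modulo an ideal into
  invertibility modulo it, and the polar part of a self-adjoint invertible is again a symmetry.
  Spectral theory is replaced by one power series: its partial sums show at once that ideals,
  adjoints, commutation and norm continuity are respected. The price is that an invertible
  self-adjoint a has to be rescaled until 1 - r^2 a^2 has norm below 1, and this needs a norm
  argument in place of the order on the spectrum.

  The obstacle is that \<open>F\<close> is only strictly continuous, so \<open>F t\<close> need not
  be norm-close to \<open>F s\<close> for t near s. A correction c taken from B avoids this: the
  products of \<open>F\<close> with c are norm-continuous, hence so is (F + c)^2 - 1, and smallness
  at s spreads to a neighbourhood. A constant c other than 0 does not vanish at infinity, so it is
  admissible on compact sets only; near infinity c is 0. Lifts on adjacent pieces need not agree at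
  the common point, but each differs there from f by an element of B, which is the jump that a tuple
  permits.\<close>

definition invsqrt_coeff :: "nat \<Rightarrow> real" where
  "invsqrt_coeff n = (- 1) ^ n * ((- 1 / 2) gchoose n)"

lemma invsqrt_coeff_0 [simp]: "invsqrt_coeff 0 = 1"
  by (simp add: invsqrt_coeff_def)

text \<open>The square of the series of (1 - x)^(-1/2) has to be the geometric series, whose
  coefficients are all 1. This is the Vandermonde identity for -1/2 + -1/2 = -1.\<close>

lemma invsqrt_coeff_convolution: "(\<Sum>i\<le>n. invsqrt_coeff i * invsqrt_coeff (n - i)) = 1"
proof -
  have "(\<Sum>i\<le>n. invsqrt_coeff i * invsqrt_coeff (n - i)) =
      (\<Sum>i\<le>n. (- 1) ^ n * (((- 1 / 2) gchoose i) * ((- 1 / 2) gchoose (n - i))))"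
    by (rule sum.cong) (auto simp: invsqrt_coeff_def mult_ac simp flip: power_add)
  also have "\<dots> = (- 1) ^ n * ((- 1 :: real) gchoose n)"
    using gbinomial_Vandermonde[of "- 1 / 2 :: real" "- 1 / 2" n]
    by (simp add: atMost_atLeast0 flip: sum_distrib_left)
  also have "\<dots> = 1"
    by (simp add: gbinomial_minus[of 1, simplified] gbinomial_pochhammer pochhammer_fact[symmetric])
  finally show ?thesis .
qed

text \<open>The sign turns the falling factorial of -1/2 into the rising factorial of 1/2; the
  coefficient is binom(2 n, n) / 4^n.\<close>

lemma invsqrt_coeff_nonneg: "0 \<le> invsqrt_coeff n"
proof -
  have "invsqrt_coeff n = pochhammer (1 / 2) n / fact n"
    by (simp add: invsqrt_coeff_def gbinomial_pochhammer flip: power_add mult.assoc mult_2)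
  then show ?thesis
    by (simp add: pochhammer_nonneg)
qed

text \<open>The convolution has nonnegative terms and value 1, and its term for i = 0 is the
  coefficient itself.\<close>

lemma invsqrt_coeff_le_1: "invsqrt_coeff n \<le> 1"
proof -
  have "invsqrt_coeff 0 * invsqrt_coeff (n - 0) \<le> (\<Sum>i\<le>n. invsqrt_coeff i * invsqrt_coeff (n - i))"
    by (rule member_le_sum) (auto simp: invsqrt_coeff_nonneg)
  then show ?thesis
    by (simp add: invsqrt_coeff_convolution)
qed

text \<open>
  The binomial series of \<open>(1 - x)\<^sup>-\<^sup>1\<^sup>/\<^sup>2\<close>.  As the unit may have norm different from 1,
  \<^class>\<open>real_normed_algebra_1\<close> is not available.
\<close>

definition invsqrt :: "'a::{real_normed_algebra,banach,monoid_mult} \<Rightarrow> 'a" where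
  "invsqrt x = (\<Sum>n. invsqrt_coeff n *\<^sub>R x ^ n)"

lemma norm_power_le:
  fixes x :: "'a::{real_normed_algebra,monoid_mult}"
  shows "norm (x ^ n) \<le> norm (1::'a) * norm x ^ n"
proof (induction n)
  case (Suc n)
  have "norm (x ^ Suc n) \<le> norm x * norm (x ^ n)"
    by (simp add: norm_mult_ineq)
  also have "\<dots> \<le> norm x * (norm (1::'a) * norm x ^ n)"
    by (intro mult_left_mono Suc) simp
  finally show ?case
    by (simp add: mult_ac)
qed simp

context
  fixes x :: "'a::{real_normed_algebra,banach,monoid_mult}"
  assumes x: "norm x < 1"
begin

lemma norm_invsqrt_term_le: "norm (invsqrt_coeff n *\<^sub>R x ^ n) \<le> norm (1::'a) * norm x ^ n"
proof -
  have "norm (invsqrt_coeff n *\<^sub>R x ^ n) \<le> 1 * norm (x ^ n)"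
    using invsqrt_coeff_le_1[of n] invsqrt_coeff_nonneg[of n] by (simp add: mult_left_le_one_le)
  then show ?thesis
    using norm_power_le[of x n] by simp
qed

lemma summable_norm_invsqrt: "summable (\<lambda>n. norm (invsqrt_coeff n *\<^sub>R x ^ n))"
  by (rule summable_comparison_test'[OF summable_mult[where c = "norm (1::'a)", OF summable_geometric[of "norm x"]]])
     (use x norm_invsqrt_term_le in auto)

lemma invsqrt_sums: "(\<lambda>n. invsqrt_coeff n *\<^sub>R x ^ n) sums invsqrt x"
  unfolding invsqrt_def
  by (rule summable_sums[OF summable_norm_cancel[OF summable_norm_invsqrt]])

text \<open>By the Cauchy product the square of the series is the geometric series, which telescopes
  against 1 - x.\<close>

lemma invsqrt_square: "invsqrt x * invsqrt x * (1 - x) = 1"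
proof -
  have "(\<lambda>n. \<Sum>i\<le>n. (invsqrt_coeff i *\<^sub>R x ^ i) * (invsqrt_coeff (n - i) *\<^sub>R x ^ (n - i)))
      sums (invsqrt x * invsqrt x)"
    unfolding invsqrt_def
    by (rule Cauchy_product_sums) (rule summable_norm_invsqrt)+
  moreover have "(\<Sum>i\<le>n. (invsqrt_coeff i *\<^sub>R x ^ i) * (invsqrt_coeff (n - i) *\<^sub>R x ^ (n - i))) = x ^ n"
    for n
  proof -
    have "(\<Sum>i\<le>n. (invsqrt_coeff i *\<^sub>R x ^ i) * (invsqrt_coeff (n - i) *\<^sub>R x ^ (n - i))) =
      (\<Sum>i\<le>n. (invsqrt_coeff i * invsqrt_coeff (n - i)) *\<^sub>R x ^ n)"
      by (rule sum.cong) (auto simp flip: power_add)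
    then show ?thesis
      by (simp add: invsqrt_coeff_convolution flip: scaleR_sum_left)
  qed
  ultimately have s: "(\<lambda>n. x ^ n) sums (invsqrt x * invsqrt x)"
    by simp
  have "(\<lambda>n. x ^ n * (1 - x)) sums (invsqrt x * invsqrt x * (1 - x))"
    by (rule sums_mult2[OF s])
  moreover have "(\<lambda>n. x ^ n * (1 - x)) = (\<lambda>n. x ^ n - x ^ Suc n)"
    by (auto simp: right_diff_distrib power_commutes)
  moreover have "(\<lambda>n. x ^ n - x ^ Suc n) sums (x ^ 0 - 0)"
    by (rule telescope_sums'[OF summable_LIMSEQ_zero[OF sums_summable[OF s]]])
  ultimately show ?thesis
    by (auto dest: sums_unique2)
qed

end

text \<open>Without its constant term the series is dominated by a geometric one with 1 / (1 - norm
  x) \<le> 2. That the bound is linear in norm x later lets a correction inherit decay at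
  infinity.\<close>

lemma norm_invsqrt_diff_1_le:
  fixes x :: "'a::{real_normed_algebra,banach,monoid_mult}"
  assumes "norm x \<le> 1 / 2"
  shows "norm (invsqrt x - 1) \<le> 2 * norm (1::'a) * norm x"
proof -
  have x: "norm x < 1"
    using assms by simp
  have s: "(\<lambda>n. invsqrt_coeff (Suc n) *\<^sub>R x ^ Suc n) sums (invsqrt x - 1)"
    using invsqrt_sums[OF x] by (subst sums_Suc_iff) simp
  have g: "(\<lambda>n. norm (1::'a) * norm x * (norm x) ^ n) sums (norm (1::'a) * norm x * (1 / (1 - norm x)))"
    by (rule sums_mult[OF geometric_sums]) (use x in auto)
  have "norm (invsqrt x - 1) \<le> norm (1::'a) * norm x * (1 / (1 - norm x))"
    using norm_invsqrt_term_le[OF x, of "Suc _"]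
    by (intro norm_sums_le[OF s g]) (simp add: mult_ac)
  also have "\<dots> \<le> norm (1::'a) * norm x * 2"
    using assms by (intro mult_left_mono) (auto simp: field_simps)
  finally show ?thesis
    by (simp add: mult_ac)
qed

lemma invsqrt_0: "invsqrt (0::'a::{real_normed_algebra,banach,monoid_mult}) = 1"
  using norm_invsqrt_diff_1_le[of "0::'a"] by simp

text \<open>A radius strictly below 1 gives a uniform majorant for the Weierstrass test. The
  threshold 1/2 for defects in later lemmas is this radius.\<close>

lemma continuous_on_invsqrt:
  "continuous_on {x :: 'a::{real_normed_algebra,banach,monoid_mult}. norm x \<le> 1 / 2} invsqrt"
proof -
  let ?S = "{x :: 'a. norm x \<le> 1 / 2}"
  let ?f = "\<lambda>n (x::'a). \<Sum>i<n. invsqrt_coeff i *\<^sub>R x ^ i"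
  have "uniform_limit ?S ?f invsqrt sequentially"
    unfolding invsqrt_def
  proof (rule Weierstrass_m_test)
    fix n and x :: 'a assume x: "x \<in> ?S"
    have "norm (invsqrt_coeff n *\<^sub>R x ^ n) \<le> norm (1::'a) * norm x ^ n"
      by (rule norm_invsqrt_term_le) (use x in auto)
    also have "\<dots> \<le> norm (1::'a) * (1 / 2) ^ n"
      using x by (intro mult_left_mono power_mono) auto
    finally show "norm (invsqrt_coeff n *\<^sub>R x ^ n) \<le> norm (1::'a) * (1 / 2) ^ n" .
  next
    show "summable (\<lambda>n. norm (1::'a) * (1 / 2) ^ n)"
      by (intro summable_mult summable_geometric) simp
  qed
  moreover have "continuous_on ?S (?f n)" for n
    by (intro continuous_intros)
  ultimately show ?thesis
    by (intro uniform_limit_theorem[where F = sequentially and f = ?f]) auto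
qed

section \<open>Lifting symmetries modulo a closed ideal\<close>

definition closed_ideal :: "'a::real_normed_algebra set \<Rightarrow> bool" where
  "closed_ideal J \<longleftrightarrow> subspace J \<and> closed J \<and> (\<forall>m. \<forall>x\<in>J. m * x \<in> J \<and> x * m \<in> J)"

lemma closed_idealD:
  assumes "closed_ideal J"
  shows "subspace J" "closed J" "x \<in> J \<Longrightarrow> m * x \<in> J" "x \<in> J \<Longrightarrow> x * m \<in> J"
    "x \<in> J \<Longrightarrow> y \<in> J \<Longrightarrow> x + y \<in> J" "x \<in> J \<Longrightarrow> y \<in> J \<Longrightarrow> x - y \<in> J"
    "x \<in> J \<Longrightarrow> r *\<^sub>R x \<in> J"
  using assms by (auto simp: closed_ideal_def subspace_add subspace_diff subspace_scale)

lemma closed_ideal_0: "closed_ideal {0}"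
  by (simp add: closed_ideal_def)

text \<open>Powers are intertwined modulo J by telescoping, and closedness of J admits the limit.
  Keeping x and x' separate allows three uses: x' the adjoint of x; J = {0}, which gives exact
  commutation; and y = 1 with x' a multiple of the unit, which evaluates the series modulo
  J.\<close>

lemma invsqrt_intertwine_mod:
  fixes x x' y :: "'a::{real_normed_algebra,banach,monoid_mult}"
  assumes J: "closed_ideal J" and x: "norm x < 1" "norm x' < 1" and xy: "x * y - y * x' \<in> J"
  shows "invsqrt x * y - y * invsqrt x' \<in> J"
proof -
  have pow: "x ^ n * y - y * x' ^ n \<in> J" for n
  proof (induction n)
    case 0
    then show ?case using J by (simp add: closed_idealD(1) subspace_0)
  next
    case (Suc n)
    have "x ^ Suc n * y - y * x' ^ Suc n = x * (x ^ n * y - y * x' ^ n) + (x * y - y * x') * x' ^ n"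
      by (simp add: algebra_simps)
    then show ?case
      by (simp only: closed_idealD[OF J] Suc xy)
  qed
  have "(\<lambda>n. (invsqrt_coeff n *\<^sub>R x ^ n) * y - y * (invsqrt_coeff n *\<^sub>R x' ^ n))
      sums (invsqrt x * y - y * invsqrt x')"
    by (intro sums_diff sums_mult sums_mult2 invsqrt_sums x)
  then have "(\<lambda>N. \<Sum>n<N. (invsqrt_coeff n *\<^sub>R x ^ n) * y - y * (invsqrt_coeff n *\<^sub>R x' ^ n))
      \<longlonglongrightarrow> invsqrt x * y - y * invsqrt x'"
    by (simp add: sums_def)
  moreover have "(\<Sum>n<N. (invsqrt_coeff n *\<^sub>R x ^ n) * y - y * (invsqrt_coeff n *\<^sub>R x' ^ n)) \<in> J" for N
  proof (rule subspace_sum[OF closed_idealD(1)[OF J]])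
    fix n
    have "(invsqrt_coeff n *\<^sub>R x ^ n) * y - y * (invsqrt_coeff n *\<^sub>R x' ^ n) =
        invsqrt_coeff n *\<^sub>R (x ^ n * y - y * x' ^ n)"
      by (simp add: scaleR_diff_right)
    then show "(invsqrt_coeff n *\<^sub>R x ^ n) * y - y * (invsqrt_coeff n *\<^sub>R x' ^ n) \<in> J"
      using closed_idealD(7)[OF J pow] by simp
  qed
  ultimately show ?thesis
    by (rule closed_sequentially[OF closed_idealD(2)[OF J], rotated])
qed

lemma invsqrt_commute:
  fixes x y :: "'a::{real_normed_algebra,banach,monoid_mult}"
  assumes "norm x < 1" and "x * y = y * x"
  shows "invsqrt x * y = y * invsqrt x"
  using invsqrt_intertwine_mod[OF closed_ideal_0 assms(1) assms(1), of y] assms(2) by simp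

lemma invsqrt_real:
  assumes "0 < r" "r < 1"
  shows "invsqrt (1 - r\<^sup>2) = 1 / (r::real)"
proof -
  have lt: "norm (1 - r\<^sup>2) < 1"
    using power_less_one_iff[of r 2] zero_less_power[of r 2] assms by simp
  have "(invsqrt (1 - r\<^sup>2))\<^sup>2 * r\<^sup>2 = 1"
    using invsqrt_square[OF lt] by (simp add: power2_eq_square)
  moreover have "0 \<le> invsqrt (1 - r\<^sup>2)"
    using sums_le[OF _ sums_zero invsqrt_sums[OF lt]] assms
    by (simp add: invsqrt_coeff_nonneg power_le_one)
  ultimately have "invsqrt (1 - r\<^sup>2) * r = 1"
    using assms by (intro power2_eq_imp_eq[of _ 1]) (simp_all add: power_mult_distrib)
  then show ?thesis
    using assms by (simp add: field_simps)
qed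

text \<open>In \<open>symmetry_lift\<close> the argument of the series is congruent to this multiple
  of the unit, so the value 1 / r is what the series becomes modulo the ideal.\<close>

lemma invsqrt_scaleR_1:
  assumes "0 < r" "r < 1"
  shows "invsqrt ((1 - r\<^sup>2) *\<^sub>R 1) = (1 / r) *\<^sub>R (1::'a::{real_normed_algebra,banach,monoid_mult})"
proof -
  have lt: "norm (1 - r\<^sup>2) < 1"
    using power_less_one_iff[of r 2] zero_less_power[of r 2] assms by simp
  have pow: "((1 - r\<^sup>2) *\<^sub>R (1::'a)) ^ n = (1 - r\<^sup>2) ^ n *\<^sub>R 1" for n
    by (induction n) auto
  have "(\<lambda>n. (invsqrt_coeff n *\<^sub>R (1 - r\<^sup>2) ^ n) *\<^sub>R (1::'a)) sums ((1 / r) *\<^sub>R 1)"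
    using invsqrt_sums[OF lt] invsqrt_real[OF assms] by (intro sums_scaleR_left) auto
  then show ?thesis
    unfolding invsqrt_def pow by (simp add: sums_iff)
qed

section \<open>Self-adjoint elements and their square roots\<close>

lemma adj_diff: "(x - y)\<^sup>\<star> = x\<^sup>\<star> - (y::'a::cstar_algebra)\<^sup>\<star>"
  by (rule linear_diff[OF bounded_linear.linear[OF bounded_linear_adj]])

lemma adj_one [simp]: "(1::'a::{cstar_algebra,monoid_mult})\<^sup>\<star> = 1"
  by (metis adj_adj adj_mult mult.left_neutral mult.right_neutral)

text \<open>By the C*-identity norm 1 equals its own square; the value 0 belongs to the zero
  algebra.\<close>

lemma norm_one_le: "norm (1::'a::{cstar_algebra,monoid_mult}) \<le> 1"
  using norm_adj_mult_self[of "1::'a"] by (cases "norm (1::'a) = 0") (auto simp: power2_eq_square)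

lemma norm_square_self_adjoint: "a\<^sup>\<star> = a \<Longrightarrow> norm (a * a) = (norm (a::'a::cstar_algebra))\<^sup>2"
  using norm_adj_mult_self[of a] by simp

lemma adj_invsqrt:
  fixes x :: "'a::{cstar_algebra,monoid_mult}"
  assumes x: "norm x < 1"
  shows "(invsqrt x)\<^sup>\<star> = invsqrt (x\<^sup>\<star>)"
proof -
  have pow: "(x ^ n)\<^sup>\<star> = (x\<^sup>\<star>) ^ n" for n
    by (induction n) (auto simp: adj_mult power_commutes)
  have "(\<lambda>n. (invsqrt_coeff n *\<^sub>R x ^ n)\<^sup>\<star>) sums (invsqrt x)\<^sup>\<star>"
    by (rule bounded_linear.sums[OF bounded_linear_adj invsqrt_sums[OF x]])
  then have "(\<lambda>n. invsqrt_coeff n *\<^sub>R (x\<^sup>\<star>) ^ n) sums (invsqrt x)\<^sup>\<star>"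
    by (simp add: adj_scaleR pow)
  moreover have "(\<lambda>n. invsqrt_coeff n *\<^sub>R (x\<^sup>\<star>) ^ n) sums invsqrt (x\<^sup>\<star>)"
    by (rule invsqrt_sums) (use x in simp)
  ultimately show ?thesis
    by (rule sums_unique2)
qed

text \<open>The root is (1 - a^2) times the inverse square root of 1 - a^2, so no second series is
  required. It commutes with everything that commutes with a because the series does.\<close>

lemma self_adjoint_sqrt:
  fixes a :: "'a::{cstar_algebra,monoid_mult}"
  assumes sa: "a\<^sup>\<star> = a" and a: "norm a < 1"
  obtains b where "b\<^sup>\<star> = b" "b * b = 1 - a * a" "\<And>c. c * a = a * c \<Longrightarrow> b * c = c * b"
proof
  let ?x = "a * a"
  let ?b = "(1 - ?x) * invsqrt ?x"
  have x: "norm ?x < 1"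
    using a sa by (simp add: norm_square_self_adjoint power_less_one_iff abs_square_less_1)
  have comm: "invsqrt ?x * c = c * invsqrt ?x" if "c * a = a * c" for c
    by (rule invsqrt_commute[OF x]) (metis that mult.assoc)
  have x1: "invsqrt ?x * (1 - ?x) = (1 - ?x) * invsqrt ?x"
    by (rule invsqrt_commute[OF x]) (simp add: algebra_simps)
  show "?b\<^sup>\<star> = ?b"
    using x1 by (simp add: adj_mult adj_diff adj_invsqrt[OF x] sa)
  show "?b * ?b = 1 - a * a"
  proof -
    have "?b * ?b = (1 - ?x) * (invsqrt ?x * ((1 - ?x) * invsqrt ?x))"
      by (simp only: mult.assoc)
    also have "\<dots> = (1 - ?x) * (invsqrt ?x * invsqrt ?x * (1 - ?x))"
      by (simp only: x1[symmetric] mult.assoc)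
    finally show ?thesis
      by (simp add: invsqrt_square[OF x])
  qed
  show "?b * c = c * ?b" if c: "c * a = a * c" for c
  proof -
    have "?x * c = c * ?x"
      by (metis c mult.assoc)
    then have "(1 - ?x) * c = c * (1 - ?x)"
      by (simp add: left_diff_distrib right_diff_distrib)
    then have "(1 - ?x) * (c * invsqrt ?x) = c * ((1 - ?x) * invsqrt ?x)"
      by (simp only: mult.assoc[symmetric])
    then show ?thesis
      by (simp only: mult.assoc comm[OF c])
  qed
qed

text \<open>\<open>a + \<i> (1 - a\<^sup>2)\<^sup>1\<^sup>/\<^sup>2\<close> is unitary, so that its imaginary part is a contraction.\<close>

lemma norm_one_minus_square_le_1:
  fixes a :: "'a::{cstar_algebra,monoid_mult}"
  assumes sa: "a\<^sup>\<star> = a" and a: "norm a < 1"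
  shows "norm (1 - a * a) \<le> 1"
proof -
  obtain b where b: "b\<^sup>\<star> = b" "b * b = 1 - a * a" "b * a = a * b"
    using self_adjoint_sqrt[OF assms] by metis
  define u where "u = a + \<i> *\<^sub>C b"
  have us: "u\<^sup>\<star> = a - \<i> *\<^sub>C b"
  proof -
    have "(- \<i>) *\<^sub>C b = - (\<i> *\<^sub>C b)"
      using scaleC_add_left[of "- \<i>" \<i> b] scaleC_of_real[of 0 b] by (simp add: eq_neg_iff_add_eq_0)
    then show ?thesis
      by (simp add: u_def adj_add adj_scaleC sa b(1))
  qed
  have ii: "\<i> *\<^sub>C \<i> *\<^sub>C (b * b) = - (b * b)"
    using scaleC_of_real[of "-1" "b * b"] by (simp add: scaleC_scaleC)
  have "u\<^sup>\<star> * u = a * a + \<i> *\<^sub>C (a * b) - \<i> *\<^sub>C (b * a) - \<i> *\<^sub>C \<i> *\<^sub>C (b * b)"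
    unfolding us unfolding u_def
    by (simp add: ring_distribs mult_scaleC_left mult_scaleC_right scaleC_add_right scaleC_diff_right)
  also have "\<dots> = 1"
    unfolding ii by (simp add: b)
  finally have "norm u \<le> 1"
    using norm_adj_mult_self[of u] norm_one_le[where 'a = 'a] by (simp add: abs_square_le_1)
  have "2 * norm b = norm (u - u\<^sup>\<star>)"
  proof -
    have "u - u\<^sup>\<star> = (2::real) *\<^sub>R (\<i> *\<^sub>C b)"
      unfolding us unfolding u_def by (simp add: scaleR_2)
    then show ?thesis
      by (simp add: norm_scaleC)
  qed
  also have "\<dots> \<le> 2"
    using norm_triangle_ineq4[of u "u\<^sup>\<star>"] \<open>norm u \<le> 1\<close> by simp
  finally have "norm (b * b) \<le> 1"
    using b(1) by (simp add: norm_square_self_adjoint power_le_one)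
  then show ?thesis
    by (simp add: b(2))
qed

text \<open>In spectral terms a^2 lies between \<eta>^2 and t^2 + \<eta>^2, and r^2 is the inverse
  of the upper bound. With l^2 = a^2 - \<eta>^2 one has 1 - r^2 a^2 = r^2 t^2 (1 - (l / t)^2), of
  norm at most r^2 t^2 = 1 - r^2 \<eta>^2.\<close>

lemma invertible_square_near_1:
  fixes a :: "'a::{cstar_algebra,monoid_mult}"
  assumes sa: "a\<^sup>\<star> = a" and inv: "a * z = 1" "z * a = 1"
  obtains r where "0 < r" "r < 1" "norm (1 - r\<^sup>2 *\<^sub>R (a * a)) < 1"
proof -
  have zsa: "z\<^sup>\<star> = z"
    by (metis adj_mult adj_one inv(1) inv(2) mult.assoc mult.left_neutral mult.right_neutral sa)
  \<comment> \<open>This scale makes \<open>\<eta> *\<^sub>R z\<close> a strict contraction, so that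
    1 - (\<eta> z)^2 has a self-adjoint root b; multiplied by a^2, that square becomes a^2 -
    \<eta>^2.\<close>
  define \<eta> where "\<eta> = 1 / (1 + norm z)"
  have \<eta>: "0 < \<eta>"
    by (simp add: \<eta>_def add_pos_nonneg)
  have c: "(\<eta> *\<^sub>R z)\<^sup>\<star> = \<eta> *\<^sub>R z" "norm (\<eta> *\<^sub>R z) < 1"
    by (auto simp: adj_scaleR zsa \<eta>_def divide_simps add_pos_nonneg)
  obtain b where b: "b\<^sup>\<star> = b" "b * b = 1 - (\<eta> *\<^sub>R z) * (\<eta> *\<^sub>R z)" "b * a = a * b"
    using self_adjoint_sqrt[OF c] inv by (metis mult_scaleR_left mult_scaleR_right)
  \<comment> \<open>The point is that \<open>a\<^sup>2 - \<eta>\<^sup>2\<close> is again the square of a self-adjoint element.\<close>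
  define l where "l = a * b"
  have lsa: "l\<^sup>\<star> = l"
    by (simp add: l_def adj_mult sa b)
  have ll: "l * l = a * a - \<eta>\<^sup>2 *\<^sub>R 1"
  proof -
    have "l * l = a * (a * (b * b))"
      unfolding l_def by (metis b(3) mult.assoc)
    also have "\<dots> = a * a - \<eta>\<^sup>2 *\<^sub>R (a * (a * z) * z)"
      by (simp add: b(2) right_diff_distrib power2_eq_square mult.assoc)
    finally show ?thesis
      by (simp add: inv)
  qed
  \<comment> \<open>l / t is a strict contraction, and t \<ge> 1 forces r < 1, as
    \<open>invsqrt_scaleR_1\<close> requires.\<close>
  define t where "t = norm l + 1"
  have t: "t \<ge> 1" "norm l < t"
    by (auto simp: t_def)
  have "norm (1 - ((1 / t) *\<^sub>R l) * ((1 / t) *\<^sub>R l)) \<le> 1"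
    by (rule norm_one_minus_square_le_1) (use t in \<open>auto simp: adj_scaleR lsa divide_simps\<close>)
  define r where "r = 1 / sqrt (t\<^sup>2 + \<eta>\<^sup>2)"
  have s: "t\<^sup>2 + \<eta>\<^sup>2 > 1"
    using t \<eta> by (metis add_le_less_mono add.right_neutral one_le_power zero_less_power)
  show ?thesis
  proof
    show "0 < r" "r < 1"
      using s by (auto simp: r_def)
    have r2: "r\<^sup>2 * (t\<^sup>2 + \<eta>\<^sup>2) = 1"
      using s by (simp add: r_def power_divide real_sqrt_pow2 del: sum_power2_eq_zero_iff)
    have "1 - r\<^sup>2 *\<^sub>R (a * a) = (r\<^sup>2 * t\<^sup>2) *\<^sub>R (1 - ((1 / t) *\<^sub>R l) * ((1 / t) *\<^sub>R l))"
    proof -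
      have "(r\<^sup>2 * t\<^sup>2) *\<^sub>R (1 - ((1 / t) *\<^sub>R l) * ((1 / t) *\<^sub>R l)) = (r\<^sup>2 * t\<^sup>2) *\<^sub>R 1 - r\<^sup>2 *\<^sub>R (l * l)"
        using t by (simp add: scaleR_diff_right power2_eq_square del: mult_cancel_left)
      also have "\<dots> = (r\<^sup>2 * (t\<^sup>2 + \<eta>\<^sup>2)) *\<^sub>R 1 - r\<^sup>2 *\<^sub>R (a * a)"
        by (simp add: ll algebra_simps)
      finally show ?thesis
        by (simp add: r2)
    qed
    then have "norm (1 - r\<^sup>2 *\<^sub>R (a * a)) \<le> r\<^sup>2 * t\<^sup>2"
      using \<open>norm (1 - ((1 / t) *\<^sub>R l) * ((1 / t) *\<^sub>R l)) \<le> 1\<close> by (simp add: abs_mult mult_left_le)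
    also have "\<dots> < r\<^sup>2 * (t\<^sup>2 + \<eta>\<^sup>2)"
      using \<eta> \<open>0 < r\<close> by simp
    finally show "norm (1 - r\<^sup>2 *\<^sub>R (a * a)) < 1"
      by (simp add: r2)
  qed
qed

text \<open>
  The approximant \<open>y\<close> of \<open>a\<close> given by real rank zero need not be congruent to \<open>a\<close> modulo \<open>J\<close>; this is
  repaired by a congruence \<open>w y w\<^sup>\<star>\<close>, which preserves invertibility however large \<open>y\<^sup>-\<^sup>1\<close> is.
\<close>

lemma invertible_lift:
  fixes a :: "'a::{cstar_algebra,monoid_mult}"
  assumes rr: "real_rank_zero TYPE('a)" and J: "closed_ideal J"
    and sa: "a\<^sup>\<star> = a" and aJ: "a * a - 1 \<in> J"
  obtains a' z where "a'\<^sup>\<star> = a'" "a' * z = 1" "z * a' = 1" "a' - a \<in> J"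
proof -
  \<comment> \<open>The precision is chosen to make (a - y) a a strict contraction.\<close>
  obtain y z where y: "y\<^sup>\<star> = y" "y * z = 1" "z * y = 1" and ya: "norm (a - y) < 1 / (1 + norm a)"
    using rr sa unfolding real_rank_zero_def
    by (metis add_pos_nonneg divide_pos_pos norm_ge_zero zero_less_one)
  define d where "d = a - y"
  \<comment> \<open>Modulo J, a^2 = 1 gives y = a - d = (1 - x) a and x a = a
    \<open>x\<^sup>\<star>\<close>. Hence w a = a \<open>w\<^sup>\<star>\<close> for w = (1 -
    x)^(-1/2), and w y \<open>w\<^sup>\<star>\<close> becomes w (1 - x) w a = a.\<close>
  define x where "x = d * a"
  have x: "norm x < 1"
  proof -
    have "norm x \<le> norm d * norm a"
      by (simp add: x_def norm_mult_ineq)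
    also have "\<dots> \<le> norm d * (1 + norm a)"
      by (simp add: mult_left_mono)
    also have "\<dots> < 1"
      using ya by (simp add: d_def pos_less_divide_eq add_pos_nonneg)
    finally show ?thesis .
  qed
  have xs: "x\<^sup>\<star> = a * d"
    by (simp add: x_def d_def adj_mult adj_diff sa y)
  define w where "w = invsqrt x"
  have ws: "w\<^sup>\<star> = invsqrt (x\<^sup>\<star>)"
    unfolding w_def by (rule adj_invsqrt[OF x])
  have wx: "w * (1 - x) = (1 - x) * w"
    unfolding w_def by (rule invsqrt_commute[OF x]) (simp add: algebra_simps)
  have ww: "w * w * (1 - x) = 1"
    unfolding w_def by (rule invsqrt_square[OF x])
  \<comment> \<open>This is the inverse of w, from which the inverse of the congruent element is
    assembled.\<close>
  define v where "v = w * (1 - x)"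
  have vw: "v * w = 1" "w * v = 1"
    using ww wx by (simp_all add: v_def flip: mult.assoc) (metis mult.assoc)+
  then have vws: "w\<^sup>\<star> * v\<^sup>\<star> = 1" "v\<^sup>\<star> * w\<^sup>\<star> = 1"
    by (simp_all flip: adj_mult)
  note ideal = closed_idealD[OF J]
  have "x * a - a * x\<^sup>\<star> = d * (a * a - 1) - (a * a - 1) * d"
    unfolding xs unfolding x_def by (simp add: algebra_simps)
  then have "x * a - a * x\<^sup>\<star> \<in> J"
    by (simp only: ideal aJ)
  then have wa: "w * a - a * w\<^sup>\<star> \<in> J"
    unfolding w_def ws[unfolded w_def] by (intro invsqrt_intertwine_mod[OF J]) (use x in auto)
  show ?thesis
  proof
    show "(w * y * w\<^sup>\<star>)\<^sup>\<star> = w * y * w\<^sup>\<star>"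
      by (simp add: adj_mult adj_adj y mult.assoc)
    show "(w * y * w\<^sup>\<star>) * (v\<^sup>\<star> * z * v) = 1"
      by (metis mult.assoc mult.left_neutral vw(2) vws(1) y(2))
    show "(v\<^sup>\<star> * z * v) * (w * y * w\<^sup>\<star>) = 1"
      by (metis mult.assoc mult.left_neutral vw(1) vws(2) y(3))
    have y_eq: "y = a - d"
      by (simp add: d_def)
    have "w * y * w\<^sup>\<star> = w * (d * (a * a - 1)) * w\<^sup>\<star> + v * (a * w\<^sup>\<star>)"
      unfolding y_eq v_def x_def by (simp add: algebra_simps)
    also have "v * (a * w\<^sup>\<star>) = v * w * a - v * (w * a - a * w\<^sup>\<star>)"
      by (simp add: algebra_simps)
    finally have "w * y * w\<^sup>\<star> - a = w * (d * (a * a - 1)) * w\<^sup>\<star> - v * (w * a - a * w\<^sup>\<star>)"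
      by (simp add: vw)
    then show "w * y * w\<^sup>\<star> - a \<in> J"
      by (simp only: ideal aJ wa)
  qed
qed

text \<open>The symmetry is the polar part of the invertible lift c, namely r c v with v = (r^2
  c^2)^(-1/2). Modulo J, c^2 = 1, so v is the scalar 1 / r there and the polar part reduces to c,
  hence to a.\<close>

lemma symmetry_lift:
  fixes a :: "'a::{cstar_algebra,monoid_mult}"
  assumes rr: "real_rank_zero TYPE('a)" and J: "closed_ideal J"
    and sa: "a\<^sup>\<star> = a" and aJ: "a * a - 1 \<in> J"
  obtains s where "s\<^sup>\<star> = s" "s * s = 1" "s - a \<in> J"
proof -
  obtain c z where c: "c\<^sup>\<star> = c" "c * z = 1" "z * c = 1" "c - a \<in> J"
    by (rule invertible_lift[OF assms])
  obtain r where r: "0 < r" "r < 1" and h: "norm (1 - r\<^sup>2 *\<^sub>R (c * c)) < 1" (is "norm ?h < 1")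
    by (rule invertible_square_near_1[OF c(1-3)])
  note ideal = closed_idealD[OF J]
  define v where "v = invsqrt ?h"
  have vc: "v * c = c * v"
    unfolding v_def by (rule invsqrt_commute[OF h]) (simp add: algebra_simps)
  have vv: "v * v * (r\<^sup>2 *\<^sub>R (c * c)) = 1"
    using invsqrt_square[OF h] by (simp add: v_def)
  have vsa: "v\<^sup>\<star> = v"
    by (simp add: v_def adj_invsqrt[OF h] adj_diff adj_scaleR adj_mult c)
  have cc: "c * c - 1 = c * (c - a) + (c - a) * a + (a * a - 1)"
    by (simp add: algebra_simps)
  have "c * c - 1 \<in> J"
    unfolding cc by (intro ideal c(4) aJ)
  then have "r\<^sup>2 *\<^sub>R (1 - c * c) \<in> J"
    using ideal by (metis minus_diff_eq scaleR_minus_right subspace_neg)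
  moreover have "?h * 1 - 1 * ((1 - r\<^sup>2) *\<^sub>R 1) = r\<^sup>2 *\<^sub>R (1 - c * c)"
    by (simp add: algebra_simps)
  moreover have "norm ((1 - r\<^sup>2) *\<^sub>R (1::'a)) < 1"
  proof -
    have "norm ((1 - r\<^sup>2) *\<^sub>R (1::'a)) \<le> (1 - r\<^sup>2) * 1"
      using r norm_one_le[where 'a = 'a] power_le_one[of r 2]
      by (simp add: mult_left_le)
    then show ?thesis
      using r by (simp add: le_less_trans)
  qed
  ultimately have "invsqrt ?h * 1 - 1 * invsqrt ((1 - r\<^sup>2) *\<^sub>R 1) \<in> J"
    by (intro invsqrt_intertwine_mod[OF J h]) auto
  then have vJ: "v - (1 / r) *\<^sub>R 1 \<in> J"
    by (simp add: v_def invsqrt_scaleR_1[OF r])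
  show ?thesis
  proof
    show "(r *\<^sub>R (c * v))\<^sup>\<star> = r *\<^sub>R (c * v)"
      by (simp add: adj_scaleR adj_mult c vsa vc)
    show "r *\<^sub>R (c * v) * r *\<^sub>R (c * v) = 1"
    proof -
      have "c * v * (c * v) = v * v * (c * c)"
        by (metis vc mult.assoc)
      then show ?thesis
        using vv by (simp add: power2_eq_square)
    qed
    have "r *\<^sub>R (c * v) - a = r *\<^sub>R (c * (v - (1 / r) *\<^sub>R 1)) + (c - a)"
      using r by (simp add: algebra_simps)
    then show "r *\<^sub>R (c * v) - a \<in> J"
      by (simp only: ideal vJ c(4))
  qed
qed

section \<open>Multipliers and strict continuity\<close>

lemma lmul_multiplier_of [simp]: "lmul (multiplier_of b) a = b * a"
  by (simp add: lmul.rep_eq multiplier_of.rep_eq blinfun_mult_right.rep_eq)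

lemma rmul_multiplier_of [simp]: "rmul (multiplier_of b) a = a * b"
  by (simp add: rmul.rep_eq multiplier_of.rep_eq blinfun_mult_left.rep_eq)

lemma norm_multiplier_of [simp]: "norm (multiplier_of b) = norm b"
proof -
  have "norm (lmul (multiplier_of b)) = norm b"
  proof (rule antisym)
    show "norm (lmul (multiplier_of b)) \<le> norm b"
      by (rule norm_blinfun_bound) (auto simp: norm_mult_ineq)
    have "norm b * norm b = norm (lmul (multiplier_of b) (b\<^sup>\<star>))"
      using norm_adj_mult_self[of "b\<^sup>\<star>"] by (simp add: adj_adj power2_eq_square)
    also have "\<dots> \<le> norm (lmul (multiplier_of b)) * norm b"
      using norm_blinfun[of "lmul (multiplier_of b)" "b\<^sup>\<star>"] by simp
    finally show "norm b \<le> norm (lmul (multiplier_of b))"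
      by (cases "norm b = 0") (auto simp: mult_le_cancel_right)
  qed
  then show ?thesis
    by (simp add: norm_multiplier_def)
qed

lemma multiplier_of_simps:
  "multiplier_of 0 = 0"
  "multiplier_of (a + b) = multiplier_of a + multiplier_of b"
  "multiplier_of (a - b) = multiplier_of a - multiplier_of b"
  "multiplier_of (- a) = - multiplier_of a"
  "multiplier_of (r *\<^sub>R a) = r *\<^sub>R multiplier_of a"
  "multiplier_of (a\<^sup>\<star>) = (multiplier_of a)\<^sup>\<star>"
  "multiplier_of (a * b) = multiplier_of a * multiplier_of b"
proof -
  note simps = ring_distribs blinfun.add_left blinfun.diff_left blinfun.minus_left blinfun.scaleR_left
  show "multiplier_of 0 = 0" by (rule multiplier_eqI) simp_all
  show "multiplier_of (a + b) = multiplier_of a + multiplier_of b"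
    by (rule multiplier_eqI) (simp_all add: simps)
  show "multiplier_of (a - b) = multiplier_of a - multiplier_of b"
    by (rule multiplier_eqI) (simp_all add: simps)
  show "multiplier_of (- a) = - multiplier_of a"
    by (rule multiplier_eqI) (simp_all add: simps)
  show "multiplier_of (r *\<^sub>R a) = r *\<^sub>R multiplier_of a"
    by (rule multiplier_eqI) (simp_all add: simps)
  show "multiplier_of (a\<^sup>\<star>) = (multiplier_of a)\<^sup>\<star>"
    by (rule multiplier_eqI) (simp_all add: adj_mult adj_adj)
  show "multiplier_of (a * b) = multiplier_of a * multiplier_of b"
    by (rule multiplier_eqI) (simp_all add: mult.assoc)
qed

lemma mult_multiplier_of: "m * multiplier_of b = multiplier_of (lmul m b)"
  by (rule multiplier_eqI) (simp_all add: multiplier_laws)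

lemma multiplier_of_mult: "multiplier_of b * m = multiplier_of (rmul m b)"
  by (rule multiplier_eqI) (simp_all add: multiplier_laws)

lemma multiplier_of_eq_iff [simp]: "multiplier_of a = multiplier_of b \<longleftrightarrow> a = b"
  using norm_multiplier_of[of "a - b"] by (auto simp: multiplier_of_simps)

lemma norm_lmul_le: "norm (lmul m b) \<le> norm m * norm b"
  using norm_blinfun[of "lmul m" b] by (simp add: norm_multiplier_def)

lemma norm_rmul_le: "norm (rmul m b) \<le> norm m * norm b"
  using norm_blinfun[of "rmul m" b] by (simp add: norm_multiplier_def norm_rmul)

text \<open>B is complete and embedded isometrically, so its image is closed.\<close>

lemma closed_ideal_range_multiplier_of: "closed_ideal (range (multiplier_of :: 'b::cstar_algebra \<Rightarrow> _))"
proof -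
  have lin: "linear (multiplier_of :: 'b \<Rightarrow> _)"
    by (rule linearI) (simp_all add: multiplier_of_simps)
  have "complete (range (multiplier_of :: 'b \<Rightarrow> _))"
  proof (rule complete_isometric_image[of 1])
    show "bounded_linear (multiplier_of :: 'b \<Rightarrow> _)"
      by (rule bounded_linear_intro[where K = 1]) (simp_all add: multiplier_of_simps)
  qed (auto simp: complete_UNIV)
  then have "closed (range (multiplier_of :: 'b \<Rightarrow> _))"
    by (rule complete_imp_closed)
  moreover have "subspace (range (multiplier_of :: 'b \<Rightarrow> _))"
    using linear_subspace_image[OF lin subspace_UNIV] .
  ultimately show ?thesis
    by (auto simp: closed_ideal_def mult_multiplier_of multiplier_of_mult)
qed

text \<open>The generators are seminorm balls with arbitrary centres. Centres f s give norm
  continuity of the orbits; conversely, norm continuity makes the preimage of each ball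
  open.\<close>

lemma continuous_map_strict_topology_iff:
  fixes f :: "real \<Rightarrow> 'b::cstar_algebra multiplier"
  shows "continuous_map (top_of_set S) strict_topology f \<longleftrightarrow>
     (\<forall>b. continuous_on S (\<lambda>t. lmul (f t) b)) \<and> (\<forall>b. continuous_on S (\<lambda>t. rmul (f t) b))"
  (is "?L \<longleftrightarrow> ?R")
proof
  assume L: ?L
  have preimage: "openin (top_of_set S) (f -` U \<inter> S)"
    if "U \<in> {{m. norm (lmul (m - m0) b) < e} | m0 b e. e > 0} \<union>
      {{m. norm (rmul (m - m0) b) < e} | m0 b e. e > 0}" for U
    using L that unfolding strict_topology_def continuous_on_generated_topo_iff topspace_euclidean_subtopology
    by (elim conjE allE[of _ U]) (rule mp)
  have "openin (top_of_set S) (f -` {m. norm (lmul (m - m0) b) < e} \<inter> S)"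
    "openin (top_of_set S) (f -` {m. norm (rmul (m - m0) b) < e} \<inter> S)" if "e > 0" for m0 b e
    using that by (intro preimage; blast)+
  then have open_preimage:
    "openin (top_of_set S) {t \<in> S. norm (lmul (f t) b - lmul m0 b) < e}"
    "openin (top_of_set S) {t \<in> S. norm (rmul (f t) b - rmul m0 b) < e}" if "e > 0" for m0 b e
    using that by (auto simp: blinfun.diff_left vimage_def Int_def conj_commute)
  have cont: "continuous_on S g" if "\<And>s e. s \<in> S \<Longrightarrow> e > 0 \<Longrightarrow> openin (top_of_set S) {t \<in> S. norm (g t - g s) < e}"
    for g :: "real \<Rightarrow> 'b"
    unfolding continuous_on_iff
  proof (intro ballI allI impI)
    fix s e :: real assume s: "s \<in> S" "e > 0"
    show "\<exists>d>0. \<forall>t\<in>S. dist t s < d \<longrightarrow> dist (g t) (g s) < e"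
      using that[OF s] s unfolding openin_euclidean_subtopology_iff by (auto simp: dist_norm)
  qed
  show ?R
    using open_preimage by (auto intro!: cont)
next
  assume R: ?R
  show ?L
    unfolding strict_topology_def continuous_on_generated_topo_iff
  proof (intro conjI allI impI)
    fix U :: "'b multiplier set"
    assume "U \<in> {{m. norm (lmul (m - m0) b) < e} | m0 b e. e > 0} \<union>
      {{m. norm (rmul (m - m0) b) < e} | m0 b e. e > 0}"
    then consider m0 b e where "U = {m. norm (lmul (m - m0) b) < e}"
      | m0 b e where "U = {m. norm (rmul (m - m0) b) < e}"
      by blast
    then show "openin (top_of_set S) (f -` U \<inter> topspace (top_of_set S))"
    proof cases
      case 1
      have "continuous_on S (\<lambda>t. norm (lmul (f t) b - lmul m0 b))"
        using R by (intro continuous_on_norm continuous_on_diff continuous_on_const) auto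
      from continuous_openin_preimage_gen[OF this open_lessThan, of e] show ?thesis
        by (simp add: 1 blinfun.diff_left vimage_def Int_def conj_commute)
    next
      case 2
      have "continuous_on S (\<lambda>t. norm (rmul (f t) b - rmul m0 b))"
        using R by (intro continuous_on_norm continuous_on_diff continuous_on_const) auto
      from continuous_openin_preimage_gen[OF this open_lessThan, of e] show ?thesis
        by (simp add: 2 blinfun.diff_left vimage_def Int_def conj_commute)
    qed
  next
    \<comment> \<open>With b = 0 the generator is all of M(B), which settles the covering
      condition.\<close>
    have "m \<in> {m'. norm (lmul (m' - m) 0) < 1}" for m :: "'b multiplier"
      by (simp add: blinfun.zero_right)
    then have "m \<in> \<Union> ({{m. norm (lmul (m - m0) b) < e} | m0 b e. e > 0} \<union>
      {{m. norm (rmul (m - m0) b) < e} | m0 b e. e > 0})" for m :: "'b multiplier"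
      by (intro UnionI[of "{m'. norm (lmul (m' - m) 0) < 1}"] UnI1 CollectI exI[of _ m] exI[of _ 0] exI[of _ 1]) auto
    then show "f ` topspace (top_of_set S) \<subseteq> \<Union> ({{m. norm (lmul (m - m0) b) < e} | m0 b e. e > 0} \<union>
      {{m. norm (rmul (m - m0) b) < e} | m0 b e. e > 0})"
      by blast
  qed
qed

lemma strict_Cb_on_iff:
  "f \<in> strict_Cb_on S \<longleftrightarrow>
     (\<forall>b. continuous_on S (\<lambda>t. lmul (f t) b)) \<and> (\<forall>b. continuous_on S (\<lambda>t. rmul (f t) b)) \<and> bounded (f ` S)"
  by (auto simp: strict_Cb_on_def continuous_map_strict_topology_iff)

text \<open>The difference splits as L t (c t - c s) + (L t - L s) (c s). Boundedness controls the
  first summand, strong continuity the second.\<close>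

lemma continuous_on_bounded_apply:
  fixes L :: "real \<Rightarrow> 'a::real_normed_vector \<Rightarrow>\<^sub>L 'b::real_normed_vector"
  assumes cont: "\<And>b. continuous_on S (\<lambda>t. L t b)" and bdd: "\<And>t. t \<in> S \<Longrightarrow> norm (L t) \<le> C"
    and c: "continuous_on S c"
  shows "continuous_on S (\<lambda>t. L t (c t))"
  unfolding continuous_on_def
proof
  fix s assume s: "s \<in> S"
  have "((\<lambda>t. c t - c s) \<longlongrightarrow> 0) (at s within S)"
    using c s by (simp add: continuous_on_def LIM_zero)
  then have "((\<lambda>t. norm (c t - c s) * C) \<longlongrightarrow> 0) (at s within S)"
    by (intro tendsto_mult_left_zero tendsto_norm_zero)
  then have "((\<lambda>t. L t (c t - c s)) \<longlongrightarrow> 0) (at s within S)"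
  proof (rule Lim_null_comparison[rotated])
    have "norm (L t (c t - c s)) \<le> norm (c t - c s) * C" if "t \<in> S" for t
      using norm_blinfun[of "L t" "c t - c s"] mult_right_mono[OF bdd[OF that], of "norm (c t - c s)"]
      by (simp add: mult.commute)
    then show "\<forall>\<^sub>F t in at s within S. norm (L t (c t - c s)) \<le> norm (c t - c s) * C"
      by (auto simp: eventually_at_filter)
  qed
  moreover have "((\<lambda>t. L t (c s)) \<longlongrightarrow> L s (c s)) (at s within S)"
    using cont s by (simp add: continuous_on_def)
  ultimately show "((\<lambda>t. L t (c t)) \<longlongrightarrow> L s (c s)) (at s within S)"
    using tendsto_add[of "\<lambda>t. L t (c t - c s)" 0 _ "\<lambda>t. L t (c s)"] by (simp add: blinfun.diff_right)
qed

lemma strict_Cb_on_bounded: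
  assumes "f \<in> strict_Cb_on S"
  obtains C where "C > 0" "\<And>t. t \<in> S \<Longrightarrow> norm (f t) \<le> C"
proof -
  have "\<exists>C>0. \<forall>y\<in>f ` S. norm y \<le> C"
    using assms by (simp only: strict_Cb_on_iff bounded_pos[symmetric])
  then show ?thesis
    using that by blast
qed

lemma continuous_on_lmul_strict:
  assumes f: "f \<in> strict_Cb_on S" and c: "continuous_on S c"
  shows "continuous_on S (\<lambda>t. lmul (f t) (c t))"
proof -
  obtain C where C: "\<And>t. t \<in> S \<Longrightarrow> norm (f t) \<le> C"
    by (rule strict_Cb_on_bounded[OF f]) blast
  show ?thesis
    by (rule continuous_on_bounded_apply[of S "\<lambda>t. lmul (f t)", OF _ _ c])
       (use f C in \<open>auto simp: strict_Cb_on_iff norm_multiplier_def\<close>)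
qed

lemma continuous_on_rmul_strict:
  assumes f: "f \<in> strict_Cb_on S" and c: "continuous_on S c"
  shows "continuous_on S (\<lambda>t. rmul (f t) (c t))"
proof -
  obtain C where C: "\<And>t. t \<in> S \<Longrightarrow> norm (f t) \<le> C"
    by (rule strict_Cb_on_bounded[OF f]) blast
  show ?thesis
    by (rule continuous_on_bounded_apply[of S "\<lambda>t. rmul (f t)", OF _ _ c])
       (use f C in \<open>auto simp: strict_Cb_on_iff norm_multiplier_def norm_rmul\<close>)
qed

lemma strict_Cb_on_add:
  assumes "f \<in> strict_Cb_on S" "g \<in> strict_Cb_on S"
  shows "(\<lambda>t. f t + g t) \<in> strict_Cb_on S"
  using assms unfolding strict_Cb_on_iff
  by (auto simp: blinfun.add_left intro!: continuous_on_add bounded_plus_comp)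

lemma strict_Cb_on_scaleR:
  assumes "f \<in> strict_Cb_on S"
  shows "(\<lambda>t. r *\<^sub>R f t) \<in> strict_Cb_on S"
  using assms unfolding strict_Cb_on_iff
  by (auto simp: blinfun.scaleR_left intro!: continuous_on_scaleR continuous_on_const bounded_scaleR_comp)

lemma strict_Cb_on_const: "(\<lambda>t. m) \<in> strict_Cb_on S"
  unfolding strict_Cb_on_iff by (auto intro: finite_imp_bounded finite_subset[of _ "{m}"])

lemma strict_Cb_on_mult:
  assumes f: "f \<in> strict_Cb_on S" and g: "g \<in> strict_Cb_on S"
  shows "(\<lambda>t. f t * g t) \<in> strict_Cb_on S"
proof -
  obtain C where "C > 0" and C: "\<And>t. t \<in> S \<Longrightarrow> norm (f t) \<le> C"
    by (rule strict_Cb_on_bounded[OF f]) blast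
  obtain D where D: "\<And>t. t \<in> S \<Longrightarrow> norm (g t) \<le> D"
    by (rule strict_Cb_on_bounded[OF g]) blast
  have "norm (f t * g t) \<le> C * D" if "t \<in> S" for t
    by (rule order_trans[OF norm_mult_ineq mult_mono]) (use that C D \<open>C > 0\<close> in auto)
  then have "bounded ((\<lambda>t. f t * g t) ` S)"
    by (auto simp: bounded_iff)
  then show ?thesis
    using f g continuous_on_lmul_strict[OF f] continuous_on_rmul_strict[OF g]
    unfolding strict_Cb_on_iff by auto
qed

lemma strict_Cb_on_adj:
  assumes "f \<in> strict_Cb_on S"
  shows "(\<lambda>t. (f t)\<^sup>\<star>) \<in> strict_Cb_on S"
  using assms unfolding strict_Cb_on_iff
  by (auto simp: bounded_iff intro!: bounded_linear.continuous_on[OF bounded_linear_adj])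

lemma strict_Cb_on_subset: "f \<in> strict_Cb_on S \<Longrightarrow> T \<subseteq> S \<Longrightarrow> f \<in> strict_Cb_on T"
  unfolding strict_Cb_on_iff by (meson bounded_subset continuous_on_subset image_mono)

section \<open>Norm-continuous functions vanishing at infinity\<close>

lemma C0_on_bounded:
  assumes "h \<in> C0_on S"
  obtains C where "\<And>t. t \<in> S \<Longrightarrow> norm (h t) \<le> C"
proof -
  obtain K where K: "K \<subseteq> S" "compact K" "\<forall>t\<in>S - K. norm (h t) < 1"
    using assms zero_less_one unfolding C0_on_def by blast
  have "continuous_on K h"
    using assms K(1) continuous_on_subset by (auto simp: C0_on_def)
  then have "bounded (h ` K)"
    by (intro compact_imp_bounded compact_continuous_image K)
  then obtain D where "\<forall>t\<in>K. norm (h t) \<le> D"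
    by (auto simp: bounded_iff)
  then have "norm (h t) \<le> max D 1" if "t \<in> S" for t
    using K that by (cases "t \<in> K") (auto simp: le_max_iff_disj less_imp_le)
  then show ?thesis
    by (rule that)
qed

lemma strict_Cb_on_multiplier_of:
  assumes "h \<in> C0_on S"
  shows "(\<lambda>t. multiplier_of (h t)) \<in> strict_Cb_on S"
proof -
  have "bounded ((\<lambda>t. multiplier_of (h t)) ` S)"
    using C0_on_bounded[OF assms] unfolding bounded_iff by (metis (no_types, lifting) imageE norm_multiplier_of)
  then show ?thesis
    using assms by (auto simp: strict_Cb_on_iff C0_on_def intro!: continuous_intros)
qed

lemma C0_on_dominated:
  assumes h: "h \<in> C0_on S" and "continuous_on S g" and "C > 0"
    and le: "\<And>t. t \<in> S \<Longrightarrow> norm (g t) \<le> C * norm (h t)"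
  shows "g \<in> C0_on S"
  unfolding C0_on_def
proof (intro CollectI conjI allI impI)
  fix e :: real assume "e > 0"
  then have "e / C > 0"
    using \<open>C > 0\<close> by simp
  then obtain K where K: "K \<subseteq> S" "compact K" "\<forall>t\<in>S - K. norm (h t) < e / C"
    using h unfolding C0_on_def by blast
  have "norm (g t) < e" if "t \<in> S - K" for t
  proof -
    have "C * norm (h t) < e"
      using K(3) that \<open>C > 0\<close> by (simp add: pos_less_divide_eq mult.commute)
    then show ?thesis
      using le[of t] that by simp
  qed
  with K show "\<exists>K\<subseteq>S. compact K \<and> (\<forall>t\<in>S - K. norm (g t) < e)"
    by blast
qed fact

lemma C0_on_scaleR:
  assumes "h \<in> C0_on S"
  shows "(\<lambda>t. r *\<^sub>R h t) \<in> C0_on S"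
  by (rule C0_on_dominated[OF assms, of _ "\<bar>r\<bar> + 1"])
     (use assms in \<open>auto simp: C0_on_def distrib_right intro!: continuous_intros\<close>)

lemma C0_on_add:
  assumes g: "g \<in> C0_on S" and h: "h \<in> C0_on S"
  shows "(\<lambda>t. g t + h t) \<in> C0_on S"
  unfolding C0_on_def
proof (intro CollectI conjI allI impI)
  show "continuous_on S (\<lambda>t. g t + h t)"
    using g h by (auto simp: C0_on_def intro: continuous_on_add)
  fix e :: real assume "e > 0"
  then have "e / 2 > 0"
    by simp
  obtain K where K: "K \<subseteq> S" "compact K" "\<forall>t\<in>S - K. norm (g t) < e / 2"
    using g \<open>e / 2 > 0\<close> unfolding C0_on_def by blast
  obtain L where L: "L \<subseteq> S" "compact L" "\<forall>t\<in>S - L. norm (h t) < e / 2"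
    using h \<open>e / 2 > 0\<close> unfolding C0_on_def by blast
  have "norm (g t + h t) < e" if "t \<in> S - (K \<union> L)" for t
  proof -
    have "norm (g t) < e / 2" "norm (h t) < e / 2"
      using K(3) L(3) that by auto
    then show ?thesis
      using norm_triangle_ineq[of "g t" "h t"] by linarith
  qed
  moreover have "compact (K \<union> L)" "K \<union> L \<subseteq> S"
    using K L by auto
  ultimately show "\<exists>K\<subseteq>S. compact K \<and> (\<forall>t\<in>S - K. norm (g t + h t) < e)"
    by blast
qed

lemma C0_on_diff: "g \<in> C0_on S \<Longrightarrow> h \<in> C0_on S \<Longrightarrow> (\<lambda>t. g t - h t) \<in> C0_on S"
  using C0_on_add[of g S "\<lambda>t. (- 1) *\<^sub>R h t"] C0_on_scaleR[of h S "- 1"] by simp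

text \<open>Closedness of T keeps the compact witness compact after intersection with T.\<close>

lemma C0_on_subset:
  assumes h: "h \<in> C0_on S" and T: "T \<subseteq> S" "closed T"
  shows "h \<in> C0_on T"
  unfolding C0_on_def
proof (intro CollectI conjI allI impI)
  show "continuous_on T h"
    using h T continuous_on_subset by (auto simp: C0_on_def)
  fix e :: real assume "e > 0"
  then obtain K where K: "K \<subseteq> S" "compact K" "\<forall>t\<in>S - K. norm (h t) < e"
    using h unfolding C0_on_def by blast
  with T show "\<exists>K\<subseteq>T. compact K \<and> (\<forall>t\<in>T - K. norm (h t) < e)"
    by (intro exI[of _ "K \<inter> T"]) auto
qed

lemma C0_on_zero: "(\<lambda>t. 0) \<in> C0_on S"
  by (auto simp: C0_on_def)

lemma C0_on_compact: "compact S \<Longrightarrow> h \<in> C0_on S \<longleftrightarrow> continuous_on S h"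
  by (auto simp: C0_on_def)

lemma C0_on_cong: "(\<And>t. t \<in> S \<Longrightarrow> g t = h t) \<Longrightarrow> g \<in> C0_on S \<longleftrightarrow> h \<in> C0_on S"
  unfolding C0_on_def by (simp cong: continuous_on_cong_simp)

lemma C0_on_lmul:
  assumes f: "f \<in> strict_Cb_on S" and h: "h \<in> C0_on S"
  shows "(\<lambda>t. lmul (f t) (h t)) \<in> C0_on S"
proof -
  obtain C where "C > 0" and C: "\<And>t. t \<in> S \<Longrightarrow> norm (f t) \<le> C"
    by (rule strict_Cb_on_bounded[OF f]) blast
  show ?thesis
  proof (rule C0_on_dominated[OF h _ \<open>C > 0\<close>])
    show "continuous_on S (\<lambda>t. lmul (f t) (h t))"
      using h by (intro continuous_on_lmul_strict[OF f]) (auto simp: C0_on_def)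
    show "norm (lmul (f t) (h t)) \<le> C * norm (h t)" if "t \<in> S" for t
      using norm_lmul_le[of "f t" "h t"] C[OF that] by (meson mult_right_mono norm_ge_zero order_trans)
  qed
qed

lemma C0_on_rmul:
  assumes f: "f \<in> strict_Cb_on S" and h: "h \<in> C0_on S"
  shows "(\<lambda>t. rmul (f t) (h t)) \<in> C0_on S"
proof -
  obtain C where "C > 0" and C: "\<And>t. t \<in> S \<Longrightarrow> norm (f t) \<le> C"
    by (rule strict_Cb_on_bounded[OF f]) blast
  show ?thesis
  proof (rule C0_on_dominated[OF h _ \<open>C > 0\<close>])
    show "continuous_on S (\<lambda>t. rmul (f t) (h t))"
      using h by (intro continuous_on_rmul_strict[OF f]) (auto simp: C0_on_def)
    show "norm (rmul (f t) (h t)) \<le> C * norm (h t)" if "t \<in> S" for t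
      using norm_rmul_le[of "f t" "h t"] C[OF that] by (meson mult_right_mono norm_ge_zero order_trans)
  qed
qed

text \<open>The symmetry is Q = G V with V = (G^2)^(-1/2). Although G is only strictly continuous, V
  is norm-continuous, since e is, and V - 1 takes values in B with norm at most 2 norm e. Hence Q -
  G = G (V - 1) vanishes at infinity along with e.\<close>

lemma strict_symmetry:
  fixes G :: "real \<Rightarrow> 'b::cstar_algebra multiplier"
  assumes G: "G \<in> strict_Cb_on S" and sa: "\<And>t. t \<in> S \<Longrightarrow> (G t)\<^sup>\<star> = G t"
    and e: "e \<in> C0_on S" and G2: "\<And>t. t \<in> S \<Longrightarrow> G t * G t = 1 - multiplier_of (e t)"
    and le: "\<And>t. t \<in> S \<Longrightarrow> norm (e t) \<le> 1 / 2"
  obtains Q k where "Q \<in> strict_Cb_on S" "k \<in> C0_on S"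
    "\<And>t. t \<in> S \<Longrightarrow> (Q t)\<^sup>\<star> = Q t \<and> Q t * Q t = 1 \<and> Q t = G t + multiplier_of (k t)"
proof -
  define V where "V t = invsqrt (multiplier_of (e t))" for t
  have "\<exists>b. V t = 1 + multiplier_of b" if "t \<in> S" for t
  proof -
    \<comment> \<open>Intertwining with y = 1 and x' = 0 compares V with the value 1 of the series
      at 0.\<close>
    have "V t * 1 - 1 * invsqrt 0 \<in> range multiplier_of"
      unfolding V_def
      by (rule invsqrt_intertwine_mod[OF closed_ideal_range_multiplier_of])
         (use le[OF that] in auto)
    then obtain b where "V t - 1 = multiplier_of b"
      by (auto simp: invsqrt_0)
    then have "V t = 1 + multiplier_of b"
      by (simp add: algebra_simps)
    then show ?thesis ..
  qed
  then obtain b where b: "\<And>t. t \<in> S \<Longrightarrow> V t = 1 + multiplier_of (b t)"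
    by metis
  have "continuous_on S (\<lambda>t. multiplier_of (e t))"
    using e unfolding C0_on_def continuous_on_iff
    by (auto simp: dist_norm simp flip: multiplier_of_simps)
  then have "continuous_on S V"
    unfolding V_def using le by (intro continuous_on_compose2[OF continuous_on_invsqrt]) auto
  then have "continuous_on S b"
    unfolding continuous_on_iff using b by (auto simp: dist_norm simp flip: multiplier_of_simps)
  then have b0: "b \<in> C0_on S"
  proof (rule C0_on_dominated[OF e])
    fix t assume t: "t \<in> S"
    have "norm (V t - 1) \<le> 2 * norm (1::'b multiplier) * norm (e t)"
      unfolding V_def using norm_invsqrt_diff_1_le[of "multiplier_of (e t)"] le[OF t] by simp
    also have "\<dots> \<le> 2 * norm (e t)"
      using norm_one_le[where 'a = "'b multiplier"] by (simp add: mult_left_le_one_le)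
    finally show "norm (b t) \<le> 2 * norm (e t)"
      by (simp add: b[OF t])
  qed simp
  define k where "k t = lmul (G t) (b t)" for t
  have k: "k \<in> C0_on S"
    unfolding k_def by (rule C0_on_lmul[OF G b0])
  have Q: "G t * V t = G t + multiplier_of (k t)" if "t \<in> S" for t
    by (simp add: b[OF that] distrib_left mult_multiplier_of k_def)
  show ?thesis
  proof (rule that[of "\<lambda>t. G t + multiplier_of (k t)" k])
    show "(\<lambda>t. G t + multiplier_of (k t)) \<in> strict_Cb_on S"
      by (intro strict_Cb_on_add strict_Cb_on_multiplier_of G k)
    fix t assume t: "t \<in> S"
    have eG: "multiplier_of (e t) = 1 - G t * G t"
      by (simp add: G2[OF t])
    have lt: "norm (multiplier_of (e t)) < 1"
      using le[OF t] by simp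
    have VG: "V t * G t = G t * V t"
      unfolding V_def by (rule invsqrt_commute[OF lt]) (simp add: eG algebra_simps)
    have "(V t)\<^sup>\<star> = V t"
      unfolding V_def adj_invsqrt[OF lt] by (simp add: eG adj_diff adj_mult sa[OF t])
    then have "(G t * V t)\<^sup>\<star> = G t * V t"
      by (simp add: adj_mult sa[OF t] VG)
    moreover have "G t * V t * (G t * V t) = V t * V t * (G t * G t)"
      by (metis VG mult.assoc)
    moreover have "V t * V t * (G t * G t) = 1"
      using invsqrt_square[OF lt] by (simp add: V_def G2[OF t])
    ultimately show "(G t + multiplier_of (k t))\<^sup>\<star> = G t + multiplier_of (k t) \<and>
        (G t + multiplier_of (k t)) * (G t + multiplier_of (k t)) = 1 \<and>
        G t + multiplier_of (k t) = G t + multiplier_of (k t)"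
      using Q[OF t] by simp
  qed (rule k)
qed

section \<open>Local lifts of projections\<close>

definition projection_lift_on :: "(real \<Rightarrow> 'b::cstar_algebra multiplier) \<Rightarrow> real set \<Rightarrow> bool" where
  "projection_lift_on f S \<longleftrightarrow> (\<exists>q\<in>strict_Cb_on S. (\<forall>t\<in>S. is_projection (q t)) \<and>
     (\<exists>k\<in>C0_on S. \<forall>t\<in>S. f t - q t = multiplier_of (k t)))"

lemma projection_lift_on_subset:
  assumes "projection_lift_on f S" "T \<subseteq> S" "closed T"
  shows "projection_lift_on f T"
proof -
  obtain q k where "q \<in> strict_Cb_on S" "k \<in> C0_on S"
    and "\<forall>t\<in>S. is_projection (q t)" "\<forall>t\<in>S. f t - q t = multiplier_of (k t)"
    using assms(1) unfolding projection_lift_on_def by blast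
  moreover have "q \<in> strict_Cb_on T" "k \<in> C0_on T"
    using calculation(1,2) assms(2,3) by (auto intro: strict_Cb_on_subset C0_on_subset)
  ultimately show ?thesis
    using assms(2) unfolding projection_lift_on_def by blast
qed

lemma is_projection_half_symmetry:
  fixes s :: "'a::{cstar_algebra,monoid_mult}"
  assumes "s\<^sup>\<star> = s" "s * s = 1"
  shows "is_projection ((1 / 2) *\<^sub>R (1 + s))"
proof -
  have "(1 + s) * (1 + s) = (2::real) *\<^sub>R (1 + s)"
    using assms(2) by (simp add: ring_distribs scaleR_2)
  then show ?thesis
    using assms(1) by (simp add: is_projection_def adj_scaleR adj_add)
qed

context
  fixes Y :: "real set" and f :: "real \<Rightarrow> 'b::cstar_algebra multiplier" and h :: "real \<Rightarrow> 'b"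
  assumes Y: "closed Y" and f: "f \<in> strict_Cb_on Y" and sa: "\<And>t. t \<in> Y \<Longrightarrow> (f t)\<^sup>\<star> = f t"
    and h: "h \<in> C0_on Y" and fh: "\<And>t. t \<in> Y \<Longrightarrow> f t * f t - f t = multiplier_of (h t)"
begin

definition double_minus_one :: "real \<Rightarrow> 'b multiplier" where
  "double_minus_one t = (2::real) *\<^sub>R f t - 1"

text \<open>This is the element of B representing 1 - (F + c)^2, where F = 2 f - 1. It is written
  out so that every summand is visibly norm-continuous in t.\<close>

definition defect :: "'b \<Rightarrow> real \<Rightarrow> 'b" where
  "defect c t = (- 4) *\<^sub>R h t - (lmul (double_minus_one t) c + rmul (double_minus_one t) c + c * c)"

lemma strict_double_minus_one: "double_minus_one \<in> strict_Cb_on Y"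
  using strict_Cb_on_add[OF strict_Cb_on_scaleR[OF f, of 2] strict_Cb_on_const[of "- 1"]]
  by (simp add: double_minus_one_def[abs_def])

lemma double_minus_one_self_adjoint: "t \<in> Y \<Longrightarrow> (double_minus_one t)\<^sup>\<star> = double_minus_one t"
  by (simp add: double_minus_one_def adj_diff adj_scaleR sa)

lemma double_minus_one_square:
  assumes "t \<in> Y"
  shows "double_minus_one t * double_minus_one t = 1 + multiplier_of (4 *\<^sub>R h t)"
proof -
  have "double_minus_one t * double_minus_one t = 1 + (4::real) *\<^sub>R (f t * f t - f t)"
    using scaleR_add_left[of 2 2 "f t * f t"] scaleR_add_left[of 2 2 "f t"]
    by (simp add: double_minus_one_def ring_distribs scaleR_diff_right scaleR_2)
  then show ?thesis
    by (simp only: fh[OF assms] multiplier_of_simps)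
qed

lemma shift_square:
  assumes "t \<in> Y"
  shows "(double_minus_one t + multiplier_of c) * (double_minus_one t + multiplier_of c) = 1 - multiplier_of (defect c t)"
  using double_minus_one_square[OF assms]
  by (simp add: defect_def multiplier_of_simps(1-5) mult_multiplier_of multiplier_of_mult
      blinfun.add_left ring_distribs(1)) (simp add: ring_distribs(2) multiplier_of_mult)

text \<open>The hypothesis on the constant function c covers two situations: S compact with any
  self-adjoint c, and S unbounded with c = 0.\<close>

lemma projection_lift_onI:
  assumes S: "S \<subseteq> Y" "closed S" and c: "c\<^sup>\<star> = c" "(\<lambda>_. c) \<in> C0_on S"
    and small: "\<And>t. t \<in> S \<Longrightarrow> norm (defect c t) \<le> 1 / 2"
  shows "projection_lift_on f S"
proof -
  have sS: "double_minus_one \<in> strict_Cb_on S"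
    by (rule strict_Cb_on_subset[OF strict_double_minus_one S(1)])
  define G where "G t = double_minus_one t + multiplier_of c" for t
  have "G \<in> strict_Cb_on S"
    unfolding G_def by (intro strict_Cb_on_add strict_Cb_on_multiplier_of sS c)
  moreover have "(G t)\<^sup>\<star> = G t" if "t \<in> S" for t
    using that S(1) c(1) by (auto simp: G_def adj_add double_minus_one_self_adjoint simp flip: multiplier_of_simps(6))
  moreover have "defect c \<in> C0_on S"
  proof -
    have "(\<lambda>t. rmul (double_minus_one t) c) \<in> C0_on S" "(\<lambda>t. lmul (double_minus_one t) c) \<in> C0_on S"
      using C0_on_lmul[OF sS c(2)] C0_on_rmul[OF sS c(2)] by auto
    moreover have "(\<lambda>t. c * c) \<in> C0_on S"
      using C0_on_lmul[OF strict_Cb_on_const[of "multiplier_of c"] c(2)] by simp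
    moreover have "(\<lambda>t. (- 4) *\<^sub>R h t) \<in> C0_on S"
      by (intro C0_on_scaleR C0_on_subset[OF h S])
    ultimately show ?thesis
      unfolding defect_def[abs_def] by (intro C0_on_diff C0_on_add)
  qed
  moreover have "G t * G t = 1 - multiplier_of (defect c t)" if "t \<in> S" for t
    using that S(1) unfolding G_def by (intro shift_square) auto
  ultimately obtain Q k where Q: "Q \<in> strict_Cb_on S" and k: "k \<in> C0_on S"
    and Qk: "\<And>t. t \<in> S \<Longrightarrow> (Q t)\<^sup>\<star> = Q t \<and> Q t * Q t = 1 \<and> Q t = G t + multiplier_of (k t)"
    using small by (rule strict_symmetry) blast+
  show ?thesis
    unfolding projection_lift_on_def
  proof (intro bexI conjI ballI)
    show "(\<lambda>t. (1 / 2) *\<^sub>R (1 + Q t)) \<in> strict_Cb_on S"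
      by (intro strict_Cb_on_scaleR strict_Cb_on_add strict_Cb_on_const Q)
    show "is_projection ((1 / 2) *\<^sub>R (1 + Q t))" if "t \<in> S" for t
      using Qk[OF that] by (intro is_projection_half_symmetry) auto
    show "(\<lambda>t. (- 1 / 2) *\<^sub>R (c + k t)) \<in> C0_on S"
      by (intro C0_on_scaleR C0_on_add c k)
    fix t assume "t \<in> S"
    then have "Q t = (2::real) *\<^sub>R f t - 1 + multiplier_of c + multiplier_of (k t)"
      using Qk by (simp add: G_def double_minus_one_def)
    then have "(1 / 2) *\<^sub>R (1 + Q t) = (1 / 2) *\<^sub>R ((2::real) *\<^sub>R f t + multiplier_of (c + k t))"
      by (simp add: multiplier_of_simps)
    also have "\<dots> = f t + (1 / 2) *\<^sub>R multiplier_of (c + k t)"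
      by (simp only: scaleR_add_right) simp
    finally show "f t - (1 / 2) *\<^sub>R (1 + Q t) = multiplier_of ((- 1 / 2) *\<^sub>R (c + k t))"
      by (simp only: multiplier_of_simps(5)) simp
  qed
qed

lemma projection_lift_near:
  assumes rr: "real_rank_zero TYPE('b multiplier)" and s: "s \<in> Y"
  obtains d where "d > 0" "projection_lift_on f (Y \<inter> cball s d)"
proof -
  have "double_minus_one s * double_minus_one s - 1 \<in> range multiplier_of"
    by (simp add: double_minus_one_square[OF s])
  then obtain u where u: "u\<^sup>\<star> = u" "u * u = 1" "u - double_minus_one s \<in> range multiplier_of"
    by (rule symmetry_lift[OF rr closed_ideal_range_multiplier_of double_minus_one_self_adjoint[OF s]])
  then obtain c where c: "multiplier_of c = u - double_minus_one s"
    by auto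
  then have "multiplier_of (c\<^sup>\<star>) = multiplier_of c"
    by (simp add: multiplier_of_simps adj_diff u(1) double_minus_one_self_adjoint[OF s])
  then have csa: "c\<^sup>\<star> = c"
    by simp
  have "multiplier_of (defect c s) = multiplier_of 0"
    using shift_square[OF s, of c] u(2) c by (simp add: multiplier_of_simps)
  then have "defect c s = 0"
    by simp
  moreover have "continuous_on Y (defect c)"
    unfolding defect_def[abs_def] using h strict_double_minus_one
    by (intro continuous_on_diff continuous_on_add continuous_on_scaleR continuous_on_const)
       (auto simp: C0_on_def strict_Cb_on_iff)
  then obtain d where d: "d > 0" "\<And>t. t \<in> Y \<Longrightarrow> dist t s < d \<Longrightarrow> dist (defect c t) (defect c s) < 1 / 2"
    using s unfolding continuous_on_iff by (metis half_gt_zero zero_less_one)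
  ultimately have small: "norm (defect c t) \<le> 1 / 2" if "t \<in> Y \<inter> cball s (d / 2)" for t
    using that less_imp_le[OF d(2)[of t]] d(1) by (simp add: dist_commute)
  \<comment> \<open>Compactness makes the constant correction c admissible; halving the radius puts
    the closed ball inside the open ball supplied by continuity.\<close>
  have K: "compact (Y \<inter> cball s (d / 2))"
    by (intro closed_Int_compact Y compact_cball)
  have "projection_lift_on f (Y \<inter> cball s (d / 2))"
    by (rule projection_lift_onI[OF _ compact_imp_closed[OF K] csa _ small])
       (simp_all add: C0_on_compact[OF K])
  moreover have "d / 2 > 0"
    using d(1) by simp
  ultimately show ?thesis
    by (intro that)
qed

lemma projection_lift_at_infinity:
  obtains K where "compact K" "\<And>S. S \<subseteq> Y \<Longrightarrow> closed S \<Longrightarrow> S \<inter> K = {} \<Longrightarrow> projection_lift_on f S"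
proof -
  \<comment> \<open>For c = 0 the defect is -4 h, so 1/8 meets the threshold 1/2.\<close>
  have "(1 / 8 :: real) > 0"
    by simp
  then obtain K where K: "K \<subseteq> Y" "compact K" "\<forall>t\<in>Y - K. norm (h t) < 1 / 8"
    using h unfolding C0_on_def by blast
  have "projection_lift_on f S" if "S \<subseteq> Y" "closed S" "S \<inter> K = {}" for S
  proof (rule projection_lift_onI[where c = 0])
    fix t assume "t \<in> S"
    then have "norm (h t) < 1 / 8"
      using K(3) that by blast
    then show "norm (defect 0 t) \<le> 1 / 2"
      by (simp add: defect_def blinfun.zero_right)
  qed (use that C0_on_zero in auto)
  with K(2) show ?thesis
    by (rule that)
qed

lemma projection_lift_on_short_intervals:
  assumes rr: "real_rank_zero TYPE('b multiplier)" and ab: "{a..b} \<subseteq> Y"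
  obtains e where "e > 0"
    "\<And>u v. a \<le> u \<Longrightarrow> u \<le> v \<Longrightarrow> v \<le> b \<Longrightarrow> v - u < e \<Longrightarrow> projection_lift_on f {u..v}"
proof -
  \<comment> \<open>Open balls serve the covering argument; the lifts live on closed balls, so that
    restricting them to closed intervals is legitimate.\<close>
  define \<G> where "\<G> = {ball s d | s d. projection_lift_on f (Y \<inter> cball s d)}"
  have "{a..b} \<subseteq> \<Union>\<G>"
  proof
    fix s assume "s \<in> {a..b}"
    then have "s \<in> Y"
      using ab by blast
    then obtain d where "d > 0" "projection_lift_on f (Y \<inter> cball s d)"
      by (rule projection_lift_near[OF rr])
    then have "s \<in> ball s d" "ball s d \<in> \<G>"
      by (auto simp: \<G>_def)
    then show "s \<in> \<Union>\<G>"
      by blast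
  qed
  moreover have "\<And>G. G \<in> \<G> \<Longrightarrow> open G"
    by (auto simp: \<G>_def)
  ultimately obtain e where e: "e > 0" "\<And>x. x \<in> {a..b} \<Longrightarrow> \<exists>G\<in>\<G>. ball x e \<subseteq> G"
    using Heine_Borel_lemma[OF compact_Icc] by metis
  show ?thesis
  proof (rule that[OF e(1)])
    fix u v assume uv: "a \<le> u" "u \<le> v" "v \<le> b" "v - u < e"
    then obtain s d where sd: "projection_lift_on f (Y \<inter> cball s d)" "ball u e \<subseteq> ball s d"
      using e(2)[of u] by (auto simp: \<G>_def)
    have "{u..v} \<subseteq> ball u e"
      using uv by (auto simp: dist_real_def)
    then have "{u..v} \<subseteq> Y \<inter> cball s d"
      using sd(2) ab uv by fastforce
    then show "projection_lift_on f {u..v}"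
      using projection_lift_on_subset[OF sd(1)] by simp
  qed
qed

end

section \<open>The corona algebra\<close>

lemma closed_points: "closed (points X)"
  by (cases X) auto

lemma algebra_I_iff:
  "f \<in> algebra_I X \<longleftrightarrow> (\<exists>h\<in>C0_on (points X). closes_up X h \<and> (\<forall>t\<in>points X. f t = multiplier_of (h t)))
     \<and> (\<forall>t. t \<notin> points X \<longrightarrow> f t = 0)"
proof
  assume "f \<in> algebra_I X"
  then show "(\<exists>h\<in>C0_on (points X). closes_up X h \<and> (\<forall>t\<in>points X. f t = multiplier_of (h t)))
      \<and> (\<forall>t. t \<notin> points X \<longrightarrow> f t = 0)"
    unfolding algebra_I_def by auto
next
  assume "(\<exists>h\<in>C0_on (points X). closes_up X h \<and> (\<forall>t\<in>points X. f t = multiplier_of (h t)))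
      \<and> (\<forall>t. t \<notin> points X \<longrightarrow> f t = 0)"
  then show "f \<in> algebra_I X"
    unfolding algebra_I_def by (auto simp: fun_eq_iff)
qed

text \<open>Since \<open>multiplier_of\<close> is injective, h inherits the matching end values on
  the circle from f.\<close>

lemma algebra_I_iff_closes_up:
  assumes "closes_up X f"
  shows "f \<in> algebra_I X \<longleftrightarrow> (\<exists>h\<in>C0_on (points X). \<forall>t\<in>points X. f t = multiplier_of (h t))
     \<and> (\<forall>t. t \<notin> points X \<longrightarrow> f t = 0)"
proof -
  have "closes_up X h" if "\<forall>t\<in>points X. f t = multiplier_of (h t)" for h
    using assms that by (auto simp: closes_up_def)
  then show ?thesis
    unfolding algebra_I_iff by blast
qed

lemma algebra_I_add:
  assumes "f \<in> algebra_I X" "g \<in> algebra_I X"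
  shows "(\<lambda>t. f t + g t) \<in> algebra_I X"
proof -
  obtain h k where "h \<in> C0_on (points X)" "closes_up X h" "\<forall>t\<in>points X. f t = multiplier_of (h t)"
    and "k \<in> C0_on (points X)" "closes_up X k" "\<forall>t\<in>points X. g t = multiplier_of (k t)"
    using assms unfolding algebra_I_iff by blast
  then show ?thesis
    using assms unfolding algebra_I_iff
    by (intro conjI bexI[of _ "\<lambda>t. h t + k t"] C0_on_add) (auto simp: closes_up_def multiplier_of_simps)
qed

lemma algebra_I_scaleR:
  assumes "f \<in> algebra_I X"
  shows "(\<lambda>t. r *\<^sub>R f t) \<in> algebra_I X"
proof -
  obtain h where "h \<in> C0_on (points X)" "closes_up X h" "\<forall>t\<in>points X. f t = multiplier_of (h t)"
    using assms unfolding algebra_I_iff by blast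
  then show ?thesis
    using assms unfolding algebra_I_iff
    by (intro conjI bexI[of _ "\<lambda>t. r *\<^sub>R h t"] C0_on_scaleR) (auto simp: closes_up_def multiplier_of_simps)
qed

lemma algebra_I_zero: "(\<lambda>t. 0) \<in> algebra_I X"
  unfolding algebra_I_iff
  by (auto simp: closes_up_def multiplier_of_simps intro!: bexI[of _ "\<lambda>t. 0"] C0_on_zero)

lemma corona_rel_refl: "f \<in> multiplier_I X \<Longrightarrow> (f, f) \<in> corona_rel X"
  by (simp add: corona_rel_def algebra_I_zero)

lemma corona_rel_sym: "(f, g) \<in> corona_rel X \<Longrightarrow> (g, f) \<in> corona_rel X"
  using algebra_I_scaleR[of "\<lambda>t. f t - g t" X "- 1"] by (simp add: corona_rel_def)

lemma corona_rel_trans: "(f, g) \<in> corona_rel X \<Longrightarrow> (g, k) \<in> corona_rel X \<Longrightarrow> (f, k) \<in> corona_rel X"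
  using algebra_I_add[of "\<lambda>t. f t - g t" X "\<lambda>t. g t - k t"] by (simp add: corona_rel_def)

lemma multiplier_I_mult:
  "f \<in> multiplier_I X \<Longrightarrow> g \<in> multiplier_I X \<Longrightarrow> (\<lambda>t. f t * g t) \<in> multiplier_I X"
  by (auto simp: multiplier_I_def closes_up_def strict_Cb_on_mult)

lemma multiplier_I_adj: "f \<in> multiplier_I X \<Longrightarrow> (\<lambda>t. (f t)\<^sup>\<star>) \<in> multiplier_I X"
  by (auto simp: multiplier_I_def closes_up_def strict_Cb_on_adj)

text \<open>The representative is the real part of any g in P, and g - f is half of g minus its
  adjoint. Product and adjoint of classes are unions over representatives, so one pointwise product
  or adjoint lying in the union already yields the congruence.\<close>

lemma corona_projection_self_adjoint_rep:
  assumes P: "corona_projection X P"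
  obtains f where "f \<in> multiplier_I X" "\<And>t. (f t)\<^sup>\<star> = f t" "P = corona_rel X `` {f}"
    "(\<lambda>t. f t * f t - f t) \<in> algebra_I X"
proof -
  obtain g where g: "g \<in> multiplier_I X" "P = corona_rel X `` {g}"
    using P unfolding corona_projection_def corona_def by (auto elim: quotientE)
  define f where "f t = (1 / 2) *\<^sub>R (g t + (g t)\<^sup>\<star>)" for t
  have "g \<in> P"
    using g corona_rel_refl by blast
  then have "(\<lambda>t. (g t)\<^sup>\<star>) \<in> corona_adj X P"
    using corona_rel_refl[OF multiplier_I_adj[OF g(1)]] unfolding corona_adj_def by blast
  then have ga: "(\<lambda>t. g t - (g t)\<^sup>\<star>) \<in> algebra_I X"
    using P g(2) by (auto simp: corona_projection_def corona_rel_def)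
  have fI: "f \<in> multiplier_I X"
    using g(1) unfolding f_def[abs_def] multiplier_I_def
    by (auto simp: closes_up_def intro!: strict_Cb_on_scaleR strict_Cb_on_add strict_Cb_on_adj)
  have "g t - f t = (1 / 2) *\<^sub>R (g t - (g t)\<^sup>\<star>)" for t
  proof -
    have "g t = (1 / 2) *\<^sub>R (g t + g t)"
      by (simp flip: scaleR_2)
    then have "g t - f t = (1 / 2) *\<^sub>R (g t + g t) - (1 / 2) *\<^sub>R (g t + (g t)\<^sup>\<star>)"
      unfolding f_def by (rule arg_cong[where f = "\<lambda>x. x - _"])
    then show ?thesis
      by (simp only: scaleR_diff_right[symmetric]) simp
  qed
  then have gf: "(g, f) \<in> corona_rel X"
    using algebra_I_scaleR[OF ga, of "1 / 2"] g(1) fI by (simp add: corona_rel_def)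
  then have Pf: "P = corona_rel X `` {f}"
    unfolding g(2) by (auto intro: corona_rel_trans corona_rel_sym)
  have "f \<in> P"
    using Pf corona_rel_refl[OF fI] by blast
  then have "(\<lambda>t. f t * f t) \<in> corona_mult X P P"
    using corona_rel_refl[OF multiplier_I_mult[OF fI fI]] unfolding corona_mult_def by blast
  then have "(f, \<lambda>t. f t * f t) \<in> corona_rel X"
    using P Pf by (auto simp: corona_projection_def)
  then have "(\<lambda>t. f t * f t - f t) \<in> algebra_I X"
    using corona_rel_sym by (fastforce simp: corona_rel_def)
  moreover have "(f t)\<^sup>\<star> = f t" for t
    by (simp add: f_def adj_scaleR adj_add adj_adj add.commute)
  ultimately show ?thesis
    using fI Pf that by blast
qed

section \<open>Gluing over the pieces of a partition\<close>

lemma closed_piece: "closed (piece X n x i)"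
proof -
  have "piece X n x i = points X \<inter> {t. 1 \<le> i \<longrightarrow> x i \<le> t} \<inter> {t. i < n \<longrightarrow> t \<le> x (i + 1)}"
    by (auto simp: piece_def)
  moreover have "closed {t. 1 \<le> i \<longrightarrow> x i \<le> t}" "closed {t. i < n \<longrightarrow> t \<le> x (i + 1)}"
    by (intro closed_Collect_imp closed_Collect_le open_Collect_const continuous_intros)+
  ultimately show ?thesis
    by (simp add: closed_Int closed_points)
qed

text \<open>The piece containing t is that of the largest index m with x m \<le> t, where index 0
  always qualifies.\<close>

lemma Union_piece: "points X = (\<Union>i\<le>n. piece X n x i)"
proof
  show "points X \<subseteq> (\<Union>i\<le>n. piece X n x i)"
  proof
    fix t assume t: "t \<in> points X"
    define I where "I = {i. i \<le> n \<and> (1 \<le> i \<longrightarrow> x i \<le> t)}"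
    have fin: "finite I"
      by (simp add: I_def)
    have ne: "I \<noteq> {}"
      by (auto simp: I_def intro!: exI[of _ 0])
    define m where "m = Max I"
    have m: "m \<in> I"
      unfolding m_def by (rule Max_in[OF fin ne])
    have "t \<le> x (m + 1)" if "m < n"
    proof (rule ccontr)
      assume "\<not> t \<le> x (m + 1)"
      then have "m + 1 \<in> I"
        using that by (simp add: I_def)
      then have "m + 1 \<le> m"
        unfolding m_def by (rule Max_ge[OF fin])
      then show False
        by simp
    qed
    then have "t \<in> piece X n x m" "m \<le> n"
      using m t by (auto simp: I_def piece_def)
    then show "t \<in> (\<Union>i\<le>n. piece X n x i)"
      by blast
  qed
qed (auto simp: piece_def)

lemma C0_on_UN:
  assumes fin: "finite I" and S: "\<And>i. i \<in> I \<Longrightarrow> closed (S i)" and h: "\<And>i. i \<in> I \<Longrightarrow> h \<in> C0_on (S i)"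
  shows "h \<in> C0_on (\<Union>i\<in>I. S i)"
  unfolding C0_on_def
proof (intro CollectI conjI allI impI)
  show "continuous_on (\<Union>i\<in>I. S i) h"
    using h by (intro continuous_on_closed_Union fin S) (auto simp: C0_on_def)
  fix e :: real assume "e > 0"
  then have "\<forall>i\<in>I. \<exists>K. K \<subseteq> S i \<and> compact K \<and> (\<forall>t\<in>S i - K. norm (h t) < e)"
    using h unfolding C0_on_def by blast
  then obtain K where K: "\<forall>i\<in>I. K i \<subseteq> S i \<and> compact (K i) \<and> (\<forall>t\<in>S i - K i. norm (h t) < e)"
    by (rule bchoice[THEN exE])
  show "\<exists>L\<subseteq>(\<Union>i\<in>I. S i). compact L \<and> (\<forall>t\<in>(\<Union>i\<in>I. S i) - L. norm (h t) < e)"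
  proof (intro exI[of _ "\<Union>i\<in>I. K i"] conjI)
    show "compact (\<Union>i\<in>I. K i)"
      using K by (intro compact_UN fin) auto
  qed (use K in blast)+
qed

text \<open>Two lifts of the same f at a common point differ by an element of B; this yields the
  jump conditions of a tuple.\<close>

lemma range_multiplier_of_diff:
  assumes "f - p = multiplier_of b" "f - q = multiplier_of c"
  shows "p - q \<in> range multiplier_of"
proof -
  have "p - q = (f - q) - (f - p)"
    by simp
  then have "p - q = multiplier_of (c - b)"
    by (simp only: assms multiplier_of_simps)
  then show ?thesis
    by blast
qed

text \<open>Each lift differs from f on its piece by a C0 function, so comparing g with the lifts
  piece by piece amounts to comparing g with f on all of X.\<close>

lemma tuple_of_projection_lifts:
  assumes f: "f \<in> multiplier_I X" and P: "P = corona_rel X `` {f}"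
    and x: "is_partition X n x" and lift: "\<And>i. i \<le> n \<Longrightarrow> projection_lift_on f (piece X n x i)"
  shows "\<exists>q. is_tuple X n x q \<and> tuple_class X n x q = P \<and> (\<forall>i\<le>n. \<forall>t\<in>piece X n x i. is_projection (q i t))"
proof -
  have "\<forall>i. \<exists>q k. i \<le> n \<longrightarrow> q \<in> strict_Cb_on (piece X n x i) \<and> k \<in> C0_on (piece X n x i) \<and>
      (\<forall>t\<in>piece X n x i. is_projection (q t) \<and> f t - q t = multiplier_of (k t))"
    using lift unfolding projection_lift_on_def by blast
  then obtain q k where q: "\<And>i. i \<le> n \<Longrightarrow> q i \<in> strict_Cb_on (piece X n x i)"
    and k: "\<And>i. i \<le> n \<Longrightarrow> k i \<in> C0_on (piece X n x i)"
    and proj: "\<And>i t. i \<le> n \<Longrightarrow> t \<in> piece X n x i \<Longrightarrow> is_projection (q i t)"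
    and qk: "\<And>i t. i \<le> n \<Longrightarrow> t \<in> piece X n x i \<Longrightarrow> f t - q i t = multiplier_of (k i t)"
    by metis
  have interior: "x i \<in> interior (points X)" if "1 \<le> i" "i \<le> n" for i
    using x that by (auto simp: is_partition_def)
  have "is_tuple X n x q"
    unfolding is_tuple_def
  proof (intro conjI allI impI ballI)
    fix i assume i: "i \<in> {1..n}"
    have xi: "x i \<in> points X"
      using interior[of i] i interior_subset by auto
    have "x j < x (j + 1)" if "1 \<le> j" "j < n" for j
      using x that by (auto simp: is_partition_def)
    moreover have "i - 1 < n"
      using i by auto
    ultimately have "x i \<in> piece X n x i" "x i \<in> piece X n x (i - 1)"
      using xi i by (force simp: piece_def dest: less_imp_le)+
    then show "q i (x i) - q (i - 1) (x i) \<in> range multiplier_of"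
      using i by (intro range_multiplier_of_diff[OF qk qk]) auto
  next
    assume X: "X = Circle"
    have "(0::real) \<in> piece X n x 0" "(1::real) \<in> piece X n x n"
      using interior[of 1] interior[of n] by (auto simp: X piece_def)
    moreover have "f 0 = f 1"
      using f X by (simp add: multiplier_I_def closes_up_def)
    ultimately show "q 0 0 - q n 1 \<in> range multiplier_of"
      using qk[of 0 0] qk[of n 1] by (intro range_multiplier_of_diff) auto
  qed (rule q)
  moreover have "tuple_class X n x q = P"
  proof -
    have diff: "(\<exists>h\<in>C0_on (points X). \<forall>t\<in>points X. f t - g t = multiplier_of (h t)) \<longleftrightarrow>
      (\<forall>i\<le>n. \<exists>h\<in>C0_on (piece X n x i). \<forall>t\<in>piece X n x i. g t - q i t = multiplier_of (h t))"
      (is "?L \<longleftrightarrow> ?R") for g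
    proof
      assume ?L
      then obtain h where h: "h \<in> C0_on (points X)" and fg: "\<And>t. t \<in> points X \<Longrightarrow> f t - g t = multiplier_of (h t)"
        by blast
      show ?R
      proof (intro allI impI bexI ballI)
        fix i assume i: "i \<le> n"
        show "(\<lambda>t. k i t - h t) \<in> C0_on (piece X n x i)"
          by (intro C0_on_diff k[OF i] C0_on_subset[OF h] closed_piece) (auto simp: piece_def)
        fix t assume t: "t \<in> piece X n x i"
        then have "g t - q i t = (f t - q i t) - (f t - g t)"
          by simp
        also have "\<dots> = multiplier_of (k i t - h t)"
          using t by (simp only: qk[OF i t] multiplier_of_simps) (simp add: fg piece_def)
        finally show "g t - q i t = multiplier_of (k i t - h t)" .
      qed
    next
      assume ?R
      then obtain h where h: "\<And>i. i \<le> n \<Longrightarrow> h i \<in> C0_on (piece X n x i)"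
        and gq: "\<And>i t. i \<le> n \<Longrightarrow> t \<in> piece X n x i \<Longrightarrow> g t - q i t = multiplier_of (h i t)"
        by metis
      have fg: "f t - g t = multiplier_of (k i t - h i t)" if "i \<le> n" "t \<in> piece X n x i" for i t
      proof -
        have "f t - g t = (f t - q i t) - (g t - q i t)"
          by simp
        then show ?thesis
          by (simp only: qk[OF that] gq[OF that] multiplier_of_simps)
      qed
      \<comment> \<open>The local formula k i t - h i t mentions the piece, and partition points lie
        in two of them. Choosing from f t - g t alone gives one function, which injectivity of
        \<open>multiplier_of\<close> identifies with every local formula.\<close>
      define d where "d t = (SOME b. f t - g t = multiplier_of b)" for t
      have d: "f t - g t = multiplier_of (d t)" if "i \<le> n" "t \<in> piece X n x i" for i t
        unfolding d_def by (rule someI[of _ "k i t - h i t"]) (rule fg[OF that])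
      have "d \<in> C0_on (piece X n x i)" if i: "i \<le> n" for i
      proof -
        have "d t = k i t - h i t" if "t \<in> piece X n x i" for t
          using fg[OF i that] d[OF i that] by simp
        moreover have "(\<lambda>t. k i t - h i t) \<in> C0_on (piece X n x i)"
          by (intro C0_on_diff k[OF i] h[OF i])
        ultimately show ?thesis
          by (rule C0_on_cong[THEN iffD2])
      qed
      then have "d \<in> C0_on (points X)"
        unfolding Union_piece[of X n x] by (intro C0_on_UN closed_piece) auto
      moreover have "\<forall>t\<in>points X. f t - g t = multiplier_of (d t)"
        unfolding Union_piece[of X n x] using d by auto
      ultimately show ?L
        by blast
    qed
    have "(f, g) \<in> corona_rel X \<longleftrightarrow> g \<in> tuple_class X n x q" for g
    proof (cases "g \<in> multiplier_I X")
      case g: True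
      have "closes_up X (\<lambda>t. f t - g t)" "\<forall>t. t \<notin> points X \<longrightarrow> f t - g t = 0"
        using f g by (auto simp: multiplier_I_def closes_up_def)
      then have "(\<lambda>t. f t - g t) \<in> algebra_I X \<longleftrightarrow>
          (\<exists>h\<in>C0_on (points X). \<forall>t\<in>points X. f t - g t = multiplier_of (h t))"
        by (simp only: algebra_I_iff_closes_up) simp
      then show ?thesis
        using f g by (simp only: corona_rel_def tuple_class_def diff) simp
    qed (auto simp: corona_rel_def tuple_class_def)
    then show ?thesis
      unfolding P by blast
  qed
  ultimately show ?thesis
    using proj by blast
qed

section \<open>Choice of the partition\<close>

lemma ex_grid_step:
  assumes "e > 0"
  obtains N :: nat where "1 \<le> N" "c / real N < e"
proof -
  obtain M where "c / e < real M"
    using reals_Archimedean2 by blast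
  then have "c < real M * e"
    using assms by (simp add: pos_divide_less_eq)
  also have "\<dots> \<le> real (Suc M) * e"
    using assms by simp
  finally have "c / real (Suc M) < e"
    by (simp add: pos_divide_less_eq mult.commute del: of_nat_Suc)
  then show ?thesis
    by (intro that[of "Suc M"]) auto
qed

theorem theorem3p2:
  fixes X :: base_space
    and P :: "(real \<Rightarrow> 'b::cstar_algebra multiplier) set"
  assumes "stable_cstar TYPE('b)"
    and "real_rank_zero TYPE('b multiplier)"
    and "corona_projection X P"
  shows "\<exists>n x f. 1 \<le> n \<and> is_partition X n x \<and> is_tuple X n x f \<and> tuple_class X n x f = P \<and>
    (\<forall>i\<le>n. \<forall>t\<in>piece X n x i. is_projection (f i t))"
proof -
  obtain f where f: "f \<in> multiplier_I X" and sa: "\<And>t. (f t)\<^sup>\<star> = f t" and P: "P = corona_rel X `` {f}"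
    and ff: "(\<lambda>t. f t * f t - f t) \<in> algebra_I X"
    using corona_projection_self_adjoint_rep[OF assms(3)] by metis
  obtain h where h: "h \<in> C0_on (points X)"
    and fh: "\<And>t. t \<in> points X \<Longrightarrow> f t * f t - f t = multiplier_of (h t)"
    using ff unfolding algebra_I_iff by blast
  have fs: "f \<in> strict_Cb_on (points X)"
    using f by (simp add: multiplier_I_def)
  note lift_short = projection_lift_on_short_intervals[OF closed_points fs sa h fh assms(2)]
  obtain K where K: "compact K"
    and lift_inf: "\<And>S. S \<subseteq> points X \<Longrightarrow> closed S \<Longrightarrow> S \<inter> K = {} \<Longrightarrow> projection_lift_on f S"
    using projection_lift_at_infinity[OF closed_points fs sa h fh] by metis
  \<comment> \<open>The bound is strict because the unbounded closed pieces contain R or -R and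
    still have to miss K.\<close>
  obtain R where R: "R > 0" "\<And>t. t \<in> K \<Longrightarrow> \<bar>t\<bar> < R"
  proof -
    obtain C where "C > 0" "\<forall>t\<in>K. norm t \<le> C"
      using compact_imp_bounded[OF K] unfolding bounded_pos by blast
    then show ?thesis
      by (intro that[of "C + 1"]) (auto simp: add_strict_increasing2)
  qed
  have "\<exists>n x. 1 \<le> n \<and> is_partition X n x \<and> (\<forall>i\<le>n. projection_lift_on f (piece X n x i))"
  proof (cases "X = Unit_Interval \<or> X = Circle")
    case X: True
    then have pX: "points X = {0..1}"
      by auto
    obtain e where e: "e > 0" "\<And>u v. 0 \<le> u \<Longrightarrow> u \<le> v \<Longrightarrow> v \<le> 1 \<Longrightarrow> v - u < e \<Longrightarrow> projection_lift_on f {u..v}"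
      using lift_short[of 0 1] pX by auto
    obtain n :: nat where n: "1 \<le> n" "1 / real n < e"
      by (rule ex_grid_step[OF e(1)])
    \<comment> \<open>The n interior points leave n + 1 pieces; x 0 and x (n + 1) are the end points
      of [0,1] and not partition points.\<close>
    define x where "x i = real i / real (n + 1)" for i
    have "is_partition X n x"
      unfolding is_partition_def pX by (auto simp: x_def divide_simps)
    moreover have "projection_lift_on f (piece X n x i)" if i: "i \<le> n" for i
    proof (rule projection_lift_on_subset[of f "{x i..x (i + 1)}"])
      have "x (i + 1) - x i = 1 / real (n + 1)"
        by (simp add: x_def field_simps)
      also have "\<dots> \<le> 1 / real n"
        using n(1) by (simp add: field_simps)
      also have "\<dots> < e"
        by (rule n(2))
      finally show "projection_lift_on f {x i..x (i + 1)}"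
        using i by (intro e(2)) (auto simp: x_def divide_simps)
      show "piece X n x i \<subseteq> {x i..x (i + 1)}"
        using i by (cases "i = 0"; cases "i = n") (auto simp: piece_def pX x_def)
    qed (rule closed_piece)
    ultimately show ?thesis
      using n(1) by blast
  next
    case False
    then consider "X = Half_Line" | "X = Real_Line"
      by (cases X) auto
    then show ?thesis
    proof cases
      case 1
      then have pX: "points X = {0..}"
        by simp
      obtain e where e: "e > 0" "\<And>u v. 0 \<le> u \<Longrightarrow> u \<le> v \<Longrightarrow> v \<le> R \<Longrightarrow> v - u < e \<Longrightarrow> projection_lift_on f {u..v}"
        using lift_short[of 0 R] pX by auto
      obtain n :: nat where n: "1 \<le> n" "R / real n < e"
        by (rule ex_grid_step[OF e(1)])
      \<comment> \<open>The last partition point is x n = R, so piece n is the unbounded one; x 0 =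
        0 is only the end of the half-line.\<close>
      define x where "x i = real i * (R / real n)" for i
      have xn: "x n = R"
        using n(1) by (simp add: x_def)
      have step: "x (i + 1) = x i + R / real n" for i
        by (simp add: x_def distrib_right add_divide_distrib)
      have xmono: "x i \<le> x j" if "i \<le> j" for i j
        using that R(1) unfolding x_def by (intro mult_right_mono) auto
      have "is_partition X n x"
        unfolding is_partition_def pX step using R(1) n(1) by (auto simp: x_def)
      moreover have "projection_lift_on f (piece X n x i)" if i: "i \<le> n" for i
      proof (cases "i = n")
        case True
        show ?thesis
        proof (rule lift_inf[OF _ closed_piece])
          show "piece X n x i \<inter> K = {}"
            using R(2) n(1) xn by (fastforce simp: piece_def True)
        qed (auto simp: piece_def)
      next
        case False
        show ?thesis
        proof (rule projection_lift_on_subset[OF _ _ closed_piece])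
          show "projection_lift_on f {x i..x (i + 1)}"
            using xmono[of "i + 1" n] xmono[of i "i + 1"] xmono[of 0 i] i False n(2) xn step[of i]
            by (intro e(2)) (auto simp: x_def)
          show "piece X n x i \<subseteq> {x i..x (i + 1)}"
            using i False by (cases "i = 0") (auto simp: piece_def pX x_def)
        qed
      qed
      ultimately show ?thesis
        using n(1) by blast
    next
      case 2
      then have pX: "points X = UNIV"
        by simp
      obtain e where e: "e > 0" "\<And>u v. - R \<le> u \<Longrightarrow> u \<le> v \<Longrightarrow> v \<le> R \<Longrightarrow> v - u < e \<Longrightarrow> projection_lift_on f {u..v}"
        using lift_short[of "- R" R] pX by auto
      obtain n :: nat where n: "1 \<le> n" "2 * R / real n < e"
        by (rule ex_grid_step[OF e(1)])
      \<comment> \<open>The shift by one puts x 1 at -R and x (n + 1) at R. Thus n steps need n + 1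
        partition points, and the pieces 0 and n + 1 are the two unbounded ones.\<close>
      define x where "x i = (real i - 1) * (2 * R / real n) - R" for i
      have x1: "x 1 = - R" and xn: "x (n + 1) = R"
        using n(1) by (simp_all add: x_def)
      have step: "x (i + 1) = x i + 2 * R / real n" for i
        by (simp add: x_def distrib_right left_diff_distrib add_divide_distrib diff_divide_distrib)
      have xmono: "x i \<le> x j" if "i \<le> j" for i j
        unfolding x_def using that R(1) by (intro diff_right_mono mult_right_mono) auto
      have "is_partition X (n + 1) x"
        unfolding is_partition_def pX using R(1) n(1) step by auto
      moreover have "projection_lift_on f (piece X (n + 1) x i)" if i: "i \<le> n + 1" for i
      proof (cases "i = 0 \<or> i = n + 1")
        case True
        show ?thesis
        proof (rule lift_inf[OF _ closed_piece])
          show "piece X (n + 1) x i \<inter> K = {}"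
            using R(2) True x1 xn by (fastforce simp: piece_def)
        qed (auto simp: piece_def)
      next
        case False
        show ?thesis
        proof (rule projection_lift_on_subset[OF _ _ closed_piece])
          show "projection_lift_on f {x i..x (i + 1)}"
            using xmono[of "i + 1" "n + 1"] xmono[of i "i + 1"] xmono[of 1 i] i False n(2) xn x1 step[of i]
            by (intro e(2)) auto
          show "piece X (n + 1) x i \<subseteq> {x i..x (i + 1)}"
            using i False by (auto simp: piece_def)
        qed
      qed
      ultimately show ?thesis
        by (metis le_add2)
    qed
  qed
  then obtain n x where nx: "1 \<le> n" "is_partition X n x" "\<And>i. i \<le> n \<Longrightarrow> projection_lift_on f (piece X n x i)"
    by blast
  then show ?thesis
    using tuple_of_projection_lifts[OF f P nx(2,3)] by blast
qed

end
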